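(* Let $(M,g_M)$ and $(N,g_N)$ be Riemannian manifolds and $p\in[1,\infty)$. Assume that $d$ is a distance on $T^*M\otimes TN$ concordant with $|\cdot|_{g_M^*\otimes g_N}$. If $(u_\ell)_{\ell\in\mathbb{N}}$ is a sequence in $\dot W^{1,p}(M,N)$ and $u\in\dot W^{1,p}(M,N)$, then the sequence $(d(Du_\ell,Du))_{\ell\in\mathbb{N}}$ converges to $0$ in $L^p(M)$ if and only if the sequence $(u_\ell)$ converges strongly to $u$ in $\dot W^{1,p}(M,N)$ and the sequence $(d(u_\ell,u))_{\ell\in\mathbb{N}}$ converges to $0$ in $L^p(M)$.
   Context: Manifolds are Hausdorff and have a countable basis; measure-theoretic notions on $M$ are defined via local charts. A map $u\colon M\to N$ is colocally weakly differentiable if $u$ is measurable and $f\circ u$ is weakly differentiable for every $f\in C^1_c(N,\mathbb{R})$. Its colocal weak derivative is the (existing and almost everywhere unique) measurable bundle morphism $Du\colon TM\to TN$ covering $u$ such that for every $f\in C^1_c(N,\mathbb{R})$, $D(f\circ u)=Df\circ Du$ almost everywhere in $M$. For linear $\xi\colon T_xM\to T_yN$, $|\xi|_{g_M^*\otimes g_N}^2=\sum_i g_N(\xi(e_i),\xi(e_i))$ with $(e_i)$ a $g_M$-orthonormal basis of $T_xM$. $\dot W^{1,p}(M,N)$ is the set of colocally weakly differentiable $u\colon M\to N$ with $|Du|_{g_M^*\otimes g_N}\in L^p(M)$ (Riemannian measure). $E=T^*M\otimes TN$ is the vector bundle over $M\times N$, with projection $\pi_{M\times N}$, whose fiber over $(x,y)$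 is $\mathcal{L}(T_xM,T_yN)$; $M\times N$ is identified with its zero section. A continuous distance $d$ on $E$ (one inducing the topology of $E$) is concordant with $|\cdot|_{g_M^*\otimes g_N}$ if (a) $d(\pi_{M\times N}(e_1),\pi_{M\times N}(e_2))\le d(e_1,e_2)$ for all $e_1,e_2\in E$; (b) there is $\kappa>0$ with $\kappa^{-1}|e|_{g_M^*\otimes g_N}\le d(e,\pi_{M\times N}(e))\le\kappa|e|_{g_M^*\otimes g_N}$ for all $e\in E$. Notation: $d(Du,Dv)(x)=d(Du(x),Dv(x))$ and $d(u,v)(x)=d((x,u(x)),(x,v(x)))$. A sequence of measurable maps $w_\ell\colon M\to Y$ into a manifold $Y$ converges locally in measure to a measurable $w$ if every $x\in M$ lies in the domain $V$ of a local chart $\psi$ such that for every open $U\subseteq Y$, $\lim_{\ell\to\infty}\mathcal{L}^m(\psi((w^{-1}(U)\cap V)\setminus w_\ell^{-1}(U)))=0$. $(u_\ell)$ converges strongly to $u$ in $\dot W^{1,p}(M,N)$ if $(Du_\ell)$ converges to $Du$ locally in measure (as maps $M\to T^*M\otimes TN$) and $(|Du_\ell|_{g_M^*\otimes g_N})$ converges to $|Du|_{g_M^*\otimes g_N}$ in $L^p(M)$. *)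

theory Defs
  imports "HOL-Analysis.Analysis"
begin

section \<open>Manifolds\<close>

text \<open>
  A manifold is a Hausdorff second countable type \<open>'a\<close> with an atlas of \<open>C\<^sup>1\<close>-compatible charts
  modelled on \<open>real ^ 'm\<close>; Riemannian metrics are continuous.  This is the least regularity for which
  the notions below make sense, and every smooth atlas and smooth metric is an instance.
  A chart is a pair \<open>(U, \<phi>)\<close>; the values of \<open>\<phi>\<close> outside \<open>U\<close> are irrelevant.
\<close>

type_synonym ('a, 'm) chart = "'a set \<times> ('a \<Rightarrow> real ^ 'm)"

definition C1_on :: "'v::real_normed_vector set \<Rightarrow> ('v \<Rightarrow> 'w::real_normed_vector) \<Rightarrow> bool" where
  "C1_on S f \<longleftrightarrow> (\<exists>f' :: 'v \<Rightarrow> 'v \<Rightarrow>\<^sub>L 'w.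
     (\<forall>x\<in>S. (f has_derivative blinfun_apply (f' x)) (at x)) \<and> continuous_on S f')"

definition is_chart :: "('a::topological_space, 'm::finite) chart \<Rightarrow> bool" where
  "is_chart c \<longleftrightarrow> open (fst c) \<and> open (snd c ` fst c) \<and>
     homeomorphism (fst c) (snd c ` fst c) (snd c) (inv_into (fst c) (snd c))"

definition transition :: "('a, 'm) chart \<Rightarrow> ('a, 'm) chart \<Rightarrow> real ^ 'm \<Rightarrow> real ^ 'm" where
  "transition c c' = snd c' \<circ> inv_into (fst c) (snd c)"

definition C1_compatible :: "('a, 'm::finite) chart \<Rightarrow> ('a, 'm) chart \<Rightarrow> bool" where
  "C1_compatible c c' \<longleftrightarrow>
     C1_on (snd c ` (fst c \<inter> fst c')) (transition c c') \<and>
     C1_on (snd c' ` (fst c \<inter> fst c')) (transition c' c)"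

definition C1_atlas :: "('a::{t2_space, second_countable_topology}, 'm::finite) chart set \<Rightarrow> bool" where
  "C1_atlas A \<longleftrightarrow> (\<forall>c\<in>A. is_chart c) \<and> (\<forall>c\<in>A. \<forall>c'\<in>A. C1_compatible c c') \<and> (\<Union>c\<in>A. fst c) = UNIV"

text \<open>The local charts of the manifold are those of the maximal atlas determined by \<open>A\<close>.\<close>

definition charts :: "('a::topological_space, 'm::finite) chart set \<Rightarrow> ('a, 'm) chart set" where
  "charts A = {c. is_chart c \<and> (\<forall>c'\<in>A. C1_compatible c c')}"

definition charts_at :: "('a::topological_space, 'm::finite) chart set \<Rightarrow> 'a \<Rightarrow> ('a, 'm) chart set" where
  "charts_at A x = {c \<in> charts A. x \<in> fst c}"


section \<open>Tangent spaces and differentials\<close>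

text \<open>
  A tangent vector at \<open>x\<close> is the family of its coordinate vectors in all charts at \<open>x\<close>, which are
  related by the differentials of the transition maps (and set to \<open>0\<close> on irrelevant charts).
  The linear structure is pointwise.
\<close>

type_synonym ('a, 'm) tvec = "('a, 'm) chart \<Rightarrow> real ^ 'm"

definition tangent_space :: "('a::topological_space, 'm::finite) chart set \<Rightarrow> 'a \<Rightarrow> ('a, 'm) tvec set" where
  "tangent_space A x = {v.
     (\<forall>c. c \<notin> charts_at A x \<longrightarrow> v c = 0) \<and>
     (\<forall>c\<in>charts_at A x. \<forall>c'\<in>charts_at A x.
        v c' = frechet_derivative (transition c c') (at (snd c x)) (v c))}"

text \<open>The tangent vector at \<open>x\<close> whose coordinates in the chart \<open>c\<close> are \<open>h\<close>.\<close>

definition coord_vector ::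
    "('a::topological_space, 'm::finite) chart set \<Rightarrow> 'a \<Rightarrow> ('a, 'm) chart \<Rightarrow> real ^ 'm \<Rightarrow> ('a, 'm) tvec" where
  "coord_vector A x c h = (\<lambda>c'. if c' \<in> charts_at A x
     then frechet_derivative (transition c c') (at (snd c x)) h else 0)"

text \<open>
  Differential \<open>Df(y)[w]\<close> of a real function, computed in some chart at \<open>y\<close> (by the chain rule the
  result does not depend on the chart).
\<close>

definition differential ::
    "('b::topological_space, 'n::finite) chart set \<Rightarrow> ('b \<Rightarrow> real) \<Rightarrow> 'b \<Rightarrow> ('b, 'n) tvec \<Rightarrow> real" where
  "differential B f y w = (let c = (SOME c. c \<in> charts_at B y) in
     frechet_derivative (f \<circ> inv_into (fst c) (snd c)) (at (snd c y)) (w c))"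

definition C1c :: "('b::topological_space, 'n::finite) chart set \<Rightarrow> ('b \<Rightarrow> real) set" where
  "C1c B = {f. (\<forall>c\<in>charts B. C1_on (snd c ` fst c) (f \<circ> inv_into (fst c) (snd c))) \<and>
     compact (closure {y. f y \<noteq> 0})}"


section \<open>The bundle of linear maps between tangent spaces\<close>

definition hom_space ::
    "('a::topological_space, 'm::finite) chart set \<Rightarrow> 'a \<Rightarrow>
     ('b::topological_space, 'n::finite) chart set \<Rightarrow> 'b \<Rightarrow> (('a, 'm) tvec \<Rightarrow> ('b, 'n) tvec) set" where
  "hom_space A x B y = {\<xi> \<in> tangent_space A x \<rightarrow>\<^sub>E tangent_space B y.
     (\<forall>v\<in>tangent_space A x. \<forall>w\<in>tangent_space A x. \<xi> (\<lambda>c. v c + w c) = (\<lambda>c. \<xi> v c + \<xi> w c)) \<and>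
     (\<forall>a. \<forall>v\<in>tangent_space A x. \<xi> (\<lambda>c. a *\<^sub>R v c) = (\<lambda>c. a *\<^sub>R \<xi> v c))}"

type_synonym ('a, 'm, 'b, 'n) hom_el = "'a \<times> 'b \<times> (('a, 'm) tvec \<Rightarrow> ('b, 'n) tvec)"

definition hom_bundle ::
    "('a::topological_space, 'm::finite) chart set \<Rightarrow> ('b::topological_space, 'n::finite) chart set \<Rightarrow>
     ('a, 'm, 'b, 'n) hom_el set" where
  "hom_bundle A B = {(x, y, \<xi>). \<xi> \<in> hom_space A x B y}"

definition bundle_proj :: "('a, 'm, 'b, 'n) hom_el \<Rightarrow> 'a \<times> 'b" where
  "bundle_proj e = (fst e, fst (snd e))"

definition zero_section :: "('a::topological_space, 'm::finite) chart set \<Rightarrow> 'a \<times> 'b \<Rightarrow>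
     ('a, 'm, 'b, 'n::finite) hom_el" where
  "zero_section A z = (fst z, snd z, restrict (\<lambda>v c. 0) (tangent_space A (fst z)))"

text \<open>Local trivialization: base coordinates and the coordinate form of the linear map.\<close>

definition triv :: "('a::topological_space, 'm::finite) chart set \<Rightarrow> ('a, 'm) chart \<Rightarrow>
     ('b, 'n::finite) chart \<Rightarrow> ('a, 'm, 'b, 'n) hom_el \<Rightarrow>
     (real ^ 'm) \<times> (real ^ 'n) \<times> ((real ^ 'm) \<Rightarrow>\<^sub>L (real ^ 'n))" where
  "triv A c c' = (\<lambda>(x, y, \<xi>). (snd c x, snd c' y, Blinfun (\<lambda>h. \<xi> (coord_vector A x c h) c')))"

definition bundle_topology ::
    "('a::topological_space, 'm::finite) chart set \<Rightarrow> ('b::topological_space, 'n::finite) chart set \<Rightarrow>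
     ('a, 'm, 'b, 'n) hom_el topology" where
  "bundle_topology A B = topology_generated_by
     {{e \<in> hom_bundle A B. bundle_proj e \<in> fst c \<times> fst c' \<and> triv A c c' e \<in> W} | c c' W.
        c \<in> charts A \<and> c' \<in> charts B \<and> open W}"


section \<open>Riemannian metrics\<close>

type_synonym ('a, 'm) metric_tensor = "'a \<Rightarrow> ('a, 'm) tvec \<Rightarrow> ('a, 'm) tvec \<Rightarrow> real"

definition riemannian_metric ::
    "('a::topological_space, 'm::finite) chart set \<Rightarrow> ('a, 'm) metric_tensor \<Rightarrow> bool" where
  "riemannian_metric A g \<longleftrightarrow>
     (\<forall>x. \<forall>u\<in>tangent_space A x. \<forall>v\<in>tangent_space A x. \<forall>w\<in>tangent_space A x. \<forall>a.
        g x v w = g x w v \<and> g x (\<lambda>c. a *\<^sub>R u c + v c) w = a * g x u w + g x v w) \<and>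
     (\<forall>x. \<forall>v\<in>tangent_space A x. v \<noteq> (\<lambda>c. 0) \<longrightarrow> g x v v > 0) \<and>
     (\<forall>c\<in>charts A. \<forall>h k. continuous_on (fst c)
        (\<lambda>x. g x (coord_vector A x c h) (coord_vector A x c k)))"

definition riemannian_manifold ::
    "('a::{t2_space, second_countable_topology}, 'm::finite) chart set \<Rightarrow> ('a, 'm) metric_tensor \<Rightarrow> bool" where
  "riemannian_manifold A g \<longleftrightarrow> C1_atlas A \<and> riemannian_metric A g"

definition orthonormal_basis :: "('a::topological_space, 'm::finite) chart set \<Rightarrow> ('a, 'm) metric_tensor \<Rightarrow>
     'a \<Rightarrow> ('a, 'm) tvec set \<Rightarrow> bool" where
  "orthonormal_basis A g x S \<longleftrightarrow> finite S \<and> S \<subseteq> tangent_space A x \<and>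
     (\<forall>v\<in>S. \<forall>w\<in>S. g x v w = (if v = w then 1 else 0)) \<and>
     (\<forall>v\<in>tangent_space A x. \<exists>a. v = (\<lambda>c. \<Sum>w\<in>S. a w *\<^sub>R w c))"

definition bundle_norm :: "('a::topological_space, 'm::finite) chart set \<Rightarrow> ('a, 'm) metric_tensor \<Rightarrow>
     ('b, 'n) metric_tensor \<Rightarrow> ('a, 'm, 'b, 'n) hom_el \<Rightarrow> real" where
  "bundle_norm A g h = (\<lambda>(x, y, \<xi>).
     sqrt (\<Sum>v\<in>(SOME S. orthonormal_basis A g x S). h y (\<xi> v) (\<xi> v)))"


section \<open>Measure theory on manifolds\<close>

definition meas_sets :: "('a::topological_space, 'm::finite) chart set \<Rightarrow> 'a set set" where
  "meas_sets A = {S. \<forall>c\<in>charts A. snd c ` (S \<inter> fst c) \<in> sets lebesgue}"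

definition AE_manifold :: "('a::topological_space, 'm::finite) chart set \<Rightarrow> ('a \<Rightarrow> bool) \<Rightarrow> bool" where
  "AE_manifold A P \<longleftrightarrow> (\<forall>c\<in>charts A. negligible (snd c ` ({x. \<not> P x} \<inter> fst c)))"

definition meas_map :: "('a::topological_space, 'm::finite) chart set \<Rightarrow> 'y topology \<Rightarrow> ('a \<Rightarrow> 'y) \<Rightarrow> bool" where
  "meas_map A T w \<longleftrightarrow> range w \<subseteq> topspace T \<and> (\<forall>U. openin T U \<longrightarrow> w -` U \<in> meas_sets A)"

definition gram_matrix :: "('a::topological_space, 'm::finite) chart set \<Rightarrow> ('a, 'm) metric_tensor \<Rightarrow>
     ('a, 'm) chart \<Rightarrow> 'a \<Rightarrow> real ^ 'm ^ 'm" where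
  "gram_matrix A g c x = (\<chi> i j. g x (coord_vector A x c (axis i 1)) (coord_vector A x c (axis j 1)))"

text \<open>
  The Riemannian measure has density \<open>sqrt (det (g\<^sub>i\<^sub>j))\<close> in each chart.  It is obtained by summation
  over the disjoint pieces of a countable cover by charts; by the change of variables formula it does
  not depend on the cover.
\<close>

definition chart_seq :: "('a::topological_space, 'm::finite) chart set \<Rightarrow> nat \<Rightarrow> ('a, 'm) chart" where
  "chart_seq A = (SOME c. range c \<subseteq> charts A \<and> (\<Union>i. fst (c i)) = UNIV)"

definition riemannian_measure ::
    "('a::topological_space, 'm::finite) chart set \<Rightarrow> ('a, 'm) metric_tensor \<Rightarrow> 'a measure" where
  "riemannian_measure A g = measure_of UNIV (meas_sets A)
     (\<lambda>S. \<Sum>i. let c = chart_seq A i; D = disjointed (\<lambda>j. fst (chart_seq A j)) i in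
        \<integral>\<^sup>+ z \<in> snd c ` (S \<inter> D).
          ennreal (sqrt (det (gram_matrix A g c (inv_into (fst c) (snd c) z)))) \<partial>lebesgue)"

definition Lp :: "'a measure \<Rightarrow> real \<Rightarrow> ('a \<Rightarrow> real) set" where
  "Lp \<mu> p = {f \<in> borel_measurable \<mu>. integrable \<mu> (\<lambda>x. \<bar>f x\<bar> powr p)}"

definition Lp_converges :: "'a measure \<Rightarrow> real \<Rightarrow> (nat \<Rightarrow> 'a \<Rightarrow> real) \<Rightarrow> ('a \<Rightarrow> real) \<Rightarrow> bool" where
  "Lp_converges \<mu> p f f0 \<longleftrightarrow> (\<forall>l. f l \<in> Lp \<mu> p) \<and> f0 \<in> Lp \<mu> p \<and>
     (\<lambda>l. \<integral>x. \<bar>f l x - f0 x\<bar> powr p \<partial>\<mu>) \<longlonglongrightarrow> 0"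

definition converges_loc_measure :: "('a::topological_space, 'm::finite) chart set \<Rightarrow> 'y topology \<Rightarrow>
     (nat \<Rightarrow> 'a \<Rightarrow> 'y) \<Rightarrow> ('a \<Rightarrow> 'y) \<Rightarrow> bool" where
  "converges_loc_measure A T w w0 \<longleftrightarrow> (\<forall>l. meas_map A T (w l)) \<and> meas_map A T w0 \<and>
     (\<forall>x. \<exists>c\<in>charts_at A x. \<forall>U. openin T U \<longrightarrow>
        (\<lambda>l. emeasure lebesgue (snd c ` ((w0 -` U \<inter> fst c) - w l -` U))) \<longlonglongrightarrow> 0)"


section \<open>Weak and colocal weak derivatives\<close>

definition loc_integrable_on :: "(real ^ 'm::finite) set \<Rightarrow> (real ^ 'm \<Rightarrow> real) \<Rightarrow> bool" where
  "loc_integrable_on S f \<longleftrightarrow> (\<forall>K. compact K \<and> K \<subseteq> S \<longrightarrow> set_integrable lebesgue K f)"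

text \<open>
  Weak gradient on an open subset of Euclidean space.  Testing with \<open>C\<^sup>1\<^sub>c\<close> functions is equivalent,
  by mollification, to testing with \<open>C\<^sup>\<infinity>\<^sub>c\<close> functions.
\<close>

definition has_weak_gradient_on ::
    "(real ^ 'm::finite \<Rightarrow> real) \<Rightarrow> (real ^ 'm \<Rightarrow> real ^ 'm) \<Rightarrow> (real ^ 'm) set \<Rightarrow> bool" where
  "has_weak_gradient_on f G S \<longleftrightarrow> loc_integrable_on S f \<and> (\<forall>i. loc_integrable_on S (\<lambda>z. G z $ i)) \<and>
     (\<forall>\<eta> i. C1_on UNIV \<eta> \<and> compact (closure {z. \<eta> z \<noteq> 0}) \<and> closure {z. \<eta> z \<noteq> 0} \<subseteq> S \<longrightarrow>
        (LINT z:S|lebesgue. f z * frechet_derivative \<eta> (at z) (axis i 1)) =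
        - (LINT z:S|lebesgue. G z $ i * \<eta> z))"

text \<open>
  \<open>\<alpha>\<close> is a weak derivative of the real function \<open>w\<close>: a field of linear forms on the tangent spaces.
\<close>

definition has_weak_derivative :: "('a::topological_space, 'm::finite) chart set \<Rightarrow>
     ('a \<Rightarrow> real) \<Rightarrow> ('a \<Rightarrow> ('a, 'm) tvec \<Rightarrow> real) \<Rightarrow> bool" where
  "has_weak_derivative A w \<alpha> \<longleftrightarrow>
     (\<forall>x. \<forall>u\<in>tangent_space A x. \<forall>v\<in>tangent_space A x. \<forall>a.
        \<alpha> x (\<lambda>c. a *\<^sub>R u c + v c) = a * \<alpha> x u + \<alpha> x v) \<and>
     (\<forall>c\<in>charts A. has_weak_gradient_on (w \<circ> inv_into (fst c) (snd c))
        (\<lambda>z. \<chi> i. let x = inv_into (fst c) (snd c) z in \<alpha> x (coord_vector A x c (axis i 1)))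
        (snd c ` fst c))"

definition weakly_differentiable :: "('a::topological_space, 'm::finite) chart set \<Rightarrow> ('a \<Rightarrow> real) \<Rightarrow> bool" where
  "weakly_differentiable A w \<longleftrightarrow> (\<exists>\<alpha>. has_weak_derivative A w \<alpha>)"

definition colocally_weakly_differentiable :: "('a::topological_space, 'm::finite) chart set \<Rightarrow>
     ('b::topological_space, 'n::finite) chart set \<Rightarrow> ('a \<Rightarrow> 'b) \<Rightarrow> bool" where
  "colocally_weakly_differentiable A B u \<longleftrightarrow>
     meas_map A euclidean u \<and> (\<forall>f\<in>C1c B. weakly_differentiable A (f \<circ> u))"

text \<open>
  A bundle morphism \<open>TM \<rightarrow> TN\<close> covering \<open>u\<close> is regarded as a map \<open>M \<rightarrow> T\<^sup>*M \<otimes> TN\<close> whose value at \<open>x\<close>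
  lies over \<open>(x, u x)\<close>.
\<close>

definition has_colocal_weak_derivative :: "('a::topological_space, 'm::finite) chart set \<Rightarrow>
     ('b::topological_space, 'n::finite) chart set \<Rightarrow> ('a \<Rightarrow> 'b) \<Rightarrow>
     ('a \<Rightarrow> ('a, 'm, 'b, 'n) hom_el) \<Rightarrow> bool" where
  "has_colocal_weak_derivative A B u Du \<longleftrightarrow>
     meas_map A (bundle_topology A B) Du \<and> (\<forall>x. bundle_proj (Du x) = (x, u x)) \<and>
     (\<forall>f\<in>C1c B. \<exists>\<alpha>. has_weak_derivative A (f \<circ> u) \<alpha> \<and>
        AE_manifold A (\<lambda>x. \<forall>v\<in>tangent_space A x.
          \<alpha> x v = differential B f (u x) (snd (snd (Du x)) v)))"

definition colocal_deriv :: "('a::topological_space, 'm::finite) chart set \<Rightarrow>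
     ('b::topological_space, 'n::finite) chart set \<Rightarrow> ('a \<Rightarrow> 'b) \<Rightarrow>
     ('a \<Rightarrow> ('a, 'm, 'b, 'n) hom_el)" where
  "colocal_deriv A B u = (SOME Du. has_colocal_weak_derivative A B u Du)"


section \<open>Sobolev maps\<close>

text \<open>
  Every colocally weakly differentiable map has a colocal weak derivative, unique almost everywhere,
  so the second conjunct only records that \<open>colocal_deriv\<close> is one.
\<close>

definition sobolev :: "('a::topological_space, 'm::finite) chart set \<Rightarrow> ('a, 'm) metric_tensor \<Rightarrow>
     ('b::topological_space, 'n::finite) chart set \<Rightarrow> ('b, 'n) metric_tensor \<Rightarrow> real \<Rightarrow> ('a \<Rightarrow> 'b) set" where
  "sobolev A g B h p = {u. colocally_weakly_differentiable A B u \<and>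
     has_colocal_weak_derivative A B u (colocal_deriv A B u) \<and>
     (\<lambda>x. bundle_norm A g h (colocal_deriv A B u x)) \<in> Lp (riemannian_measure A g) p}"

definition strongly_converges :: "('a::topological_space, 'm::finite) chart set \<Rightarrow> ('a, 'm) metric_tensor \<Rightarrow>
     ('b::topological_space, 'n::finite) chart set \<Rightarrow> ('b, 'n) metric_tensor \<Rightarrow> real \<Rightarrow>
     (nat \<Rightarrow> 'a \<Rightarrow> 'b) \<Rightarrow> ('a \<Rightarrow> 'b) \<Rightarrow> bool" where
  "strongly_converges A g B h p u u0 \<longleftrightarrow>
     converges_loc_measure A (bundle_topology A B) (\<lambda>l. colocal_deriv A B (u l)) (colocal_deriv A B u0) \<and>
     Lp_converges (riemannian_measure A g) p
       (\<lambda>l x. bundle_norm A g h (colocal_deriv A B (u l) x))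
       (\<lambda>x. bundle_norm A g h (colocal_deriv A B u0 x))"

definition concordant :: "('a::topological_space, 'm::finite) chart set \<Rightarrow> ('a, 'm) metric_tensor \<Rightarrow>
     ('b::topological_space, 'n::finite) chart set \<Rightarrow> ('b, 'n) metric_tensor \<Rightarrow>
     (('a, 'm, 'b, 'n) hom_el \<Rightarrow> ('a, 'm, 'b, 'n) hom_el \<Rightarrow> real) \<Rightarrow> bool" where
  "concordant A g B h d \<longleftrightarrow>
     Metric_space (hom_bundle A B) d \<and>
     Metric_space.mtopology (hom_bundle A B) d = bundle_topology A B \<and>
     (\<forall>e1\<in>hom_bundle A B. \<forall>e2\<in>hom_bundle A B.
        d (zero_section A (bundle_proj e1)) (zero_section A (bundle_proj e2)) \<le> d e1 e2) \<and>
     (\<exists>\<kappa>>0. \<forall>e\<in>hom_bundle A B.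
        inverse \<kappa> * bundle_norm A g h e \<le> d e (zero_section A (bundle_proj e)) \<and>
        d e (zero_section A (bundle_proj e)) \<le> \<kappa> * bundle_norm A g h e)"

end

theory Submission
  imports Defs
begin

text \<open>
  Concordance bounds \<open>||Du\<^sub>l| - |Du||\<close> by a multiple of \<open>d(Du\<^sub>l, Du) + |Du|\<close>, and \<open>d(Du\<^sub>l, Du)\<close> by a multiple of
  \<open>||Du\<^sub>l| - |Du|| + d(u\<^sub>l, u) + |Du|\<close>.  Each time a quantity that should tend to \<open>0\<close> in \<open>L\<^sup>p\<close> is bounded by
  one known to do so plus a fixed \<open>L\<^sup>p\<close> function, so by dominated convergence it is enough that
  every subsequence has a further subsequence along which \<open>Du\<^sub>l \<longrightarrow> Du\<close> almost everywhere.
  From \<open>L\<^sup>p\<close> convergence of the distances this is classical; from local convergence in measure it is the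
  Borel--Cantelli lemma applied simultaneously to a countable base of the bundle and a countable
  cover of \<open>M\<close> by charts.  Since \<open>Du\<^sub>l(x)\<close> always lies over \<open>x\<close>, only continuity of the norm along the
  fibres over a fixed \<open>x\<close> is needed.
\<close>

section \<open>Functions of class \<open>C\<^sup>1\<close>\<close>

text \<open>Quantitatively, concordance compares the norm of an element with its distance to its
  foot in the zero section, and the distance of two feet with that of the elements above them. Two
  general elements can therefore be compared only along a path through their feet, and the fixed
  multiple of |Du| in both bounds is the price of that detour. Almost everywhere convergence in the
  bundle topology is what the two sides share, and trading it for local convergence in measure meets
  two obstacles. The measure of \<open>M\<close> may be infinite, and then almost everywhere
  convergence does not give convergence in measure; but the notion is local, so a chart can be
  shrunk until its image is bounded. Moreover it refers to Lebesgue measure in charts, whereas the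
  integrals use the Riemannian measure; their null sets are matched through the positivity of the
  density and the C^1 transitions. The countable base of the bundle comes from its trivializations.
  It also makes \<open>d\<close> separable, which is why the distance of two measurable sections is
  a measurable function.\<close>

lemma C1_on_iff_frechet:
  "C1_on S f \<longleftrightarrow> (\<forall>x\<in>S. f differentiable (at x)) \<and>
     continuous_on S (\<lambda>x. Blinfun (frechet_derivative f (at x)))" (is "?L \<longleftrightarrow> ?R")
proof
  assume ?L
  then obtain f' where f': "\<And>x. x \<in> S \<Longrightarrow> (f has_derivative blinfun_apply (f' x)) (at x)"
    and cont: "continuous_on S f'"
    unfolding C1_on_def by blast
  \<comment> \<open>Derivatives are unique, so the existential witness in \<open>C1_on\<close> is
    forced on \<open>S\<close>; this is what makes the property local.\<close>
  have "Blinfun (frechet_derivative f (at x)) = f' x" if "x \<in> S" for x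
    using frechet_derivative_at[OF f'[OF that]] by (metis blinfun_apply_inverse)
  then show ?R
    using f' cont by (auto simp: differentiable_def cong: continuous_on_cong)
next
  assume R: ?R
  have "(f has_derivative blinfun_apply (Blinfun (frechet_derivative f (at x)))) (at x)" if "x \<in> S" for x
    using R that bounded_linear_Blinfun_apply frechet_derivative_works has_derivative_bounded_linear
    by metis
  then show ?L
    unfolding C1_on_def using R by (intro exI[of _ "\<lambda>x. Blinfun (frechet_derivative f (at x))"]) auto
qed

lemma C1_on_subset: "C1_on T f \<Longrightarrow> S \<subseteq> T \<Longrightarrow> C1_on S f"
  unfolding C1_on_def by (meson continuous_on_subset subsetD)

lemma C1_on_differentiable: "C1_on S f \<Longrightarrow> x \<in> S \<Longrightarrow> f differentiable (at x)"
  unfolding C1_on_iff_frechet by blast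

lemma C1_on_compose:
  assumes f: "C1_on S f" and g: "C1_on T g" and sub: "f ` S \<subseteq> T"
  shows "C1_on S (g \<circ> f)"
proof -
  obtain f' where f': "\<And>x. x \<in> S \<Longrightarrow> (f has_derivative blinfun_apply (f' x)) (at x)"
    and contf: "continuous_on S f'"
    using f unfolding C1_on_def by blast
  obtain g' where g': "\<And>x. x \<in> T \<Longrightarrow> (g has_derivative blinfun_apply (g' x)) (at x)"
    and contg: "continuous_on T g'"
    using g unfolding C1_on_def by blast
  have "continuous_on S f"
  proof (rule continuous_at_imp_continuous_on, rule ballI)
    show "isCont f x" if "x \<in> S" for x
      by (rule has_derivative_continuous, rule f', rule that)
  qed
  then have "continuous_on S (\<lambda>x. g' (f x))"
    by (rule continuous_on_compose2[OF contg _ sub])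
  then have "continuous_on S (\<lambda>x. g' (f x) o\<^sub>L f' x)"
    using contf by (rule bounded_bilinear.continuous_on[OF bounded_bilinear_blinfun_compose])
  moreover have "(g \<circ> f has_derivative blinfun_apply (g' (f x) o\<^sub>L f' x)) (at x)" if "x \<in> S" for x
    using diff_chain_at[OF f'[OF that] g'] that sub by (simp add: image_subset_iff blinfun_compose.rep_eq)
  ultimately show ?thesis
    unfolding C1_on_def by (intro exI[of _ "\<lambda>x. g' (f x) o\<^sub>L f' x"] conjI ballI)
qed

lemma C1_on_transform:
  assumes "C1_on S f" "open S" "\<And>x. x \<in> S \<Longrightarrow> f x = g x"
  shows "C1_on S g"
proof -
  obtain f' where f': "\<And>x. x \<in> S \<Longrightarrow> (f has_derivative blinfun_apply (f' x)) (at x)"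
    and cont: "continuous_on S f'"
    using assms(1) unfolding C1_on_def by blast
  have "(g has_derivative blinfun_apply (f' x)) (at x)" if "x \<in> S" for x
    using has_derivative_transform_within_open[OF f'[OF that] assms(2) that assms(3)] .
  then show ?thesis
    unfolding C1_on_def using cont by (intro exI[of _ f'] conjI ballI)
qed

text \<open>Local derivative fields need no gluing, since each is the Frechet derivative;
  differentiability and continuity at a point are read off in one neighbourhood.\<close>

lemma C1_on_locally:
  assumes "\<And>x. x \<in> S \<Longrightarrow> \<exists>T. open T \<and> x \<in> T \<and> C1_on T f"
  shows "C1_on S f"
  unfolding C1_on_iff_frechet
proof (intro conjI ballI continuous_at_imp_continuous_on)
  fix x assume "x \<in> S"
  then obtain T where T: "open T" "x \<in> T" "C1_on T f"
    using assms by blast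
  then show "f differentiable at x"
    by (auto simp: C1_on_iff_frechet)
  show "isCont (\<lambda>x. Blinfun (frechet_derivative f (at x))) x"
    using T by (auto simp: C1_on_iff_frechet continuous_on_eq_continuous_at)
qed

text \<open>Source and target have the same dimension, so a differentiable map keeps null sets null.
  Applied to transitions, this makes null sets independent of the chart.\<close>

lemma C1_on_negligible_image:
  fixes f :: "real ^ 'm \<Rightarrow> real ^ 'm"
  assumes "C1_on S f" "negligible S"
  shows "negligible (f ` S)"
  using assms
  by (intro negligible_differentiable_image_negligible)
    (auto simp: differentiable_on_def intro: C1_on_differentiable differentiable_at_withinI)


section \<open>Charts\<close>

lemma chart_inv: "is_chart c \<Longrightarrow> x \<in> fst c \<Longrightarrow> inv_into (fst c) (snd c) (snd c x) = x"
  unfolding is_chart_def homeomorphism_def by blast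

lemma chart_inj: "is_chart c \<Longrightarrow> inj_on (snd c) (fst c)"
  by (metis chart_inv inj_on_inverseI)

lemma chart_open_dom: "is_chart c \<Longrightarrow> open (fst c)"
  unfolding is_chart_def by blast

lemma chart_continuous: "is_chart c \<Longrightarrow> continuous_on (fst c) (snd c)"
  unfolding is_chart_def homeomorphism_def by blast

lemma chart_inv_continuous:
  "is_chart c \<Longrightarrow> continuous_on (snd c ` fst c) (inv_into (fst c) (snd c))"
  unfolding is_chart_def homeomorphism_def by blast

lemma chart_open_image:
  assumes "is_chart c" "open V" "V \<subseteq> fst c"
  shows "open (snd c ` V)"
proof -
  have hom: "homeomorphism (fst c) (snd c ` fst c) (snd c) (inv_into (fst c) (snd c))"
    and "open (snd c ` fst c)"
    using assms by (auto simp: is_chart_def)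
  have "openin (top_of_set (fst c)) V"
    using assms by (simp add: openin_open_eq chart_open_dom)
  with hom have "openin (top_of_set (snd c ` fst c)) (snd c ` V)"
    by (rule homeomorphism_imp_open_map)
  then show ?thesis
    using \<open>open (snd c ` fst c)\<close> by (rule openin_open_trans)
qed

lemma chart_image_Int:
  assumes "is_chart c" "S \<subseteq> fst c" "T \<subseteq> fst c"
  shows "snd c ` (S \<inter> T) = snd c ` S \<inter> snd c ` T"
  using inj_on_image_Int[OF chart_inj[OF assms(1)]] assms by blast

lemma chart_image_iff:
  assumes "is_chart c" "x \<in> fst c" "S \<subseteq> fst c"
  shows "snd c x \<in> snd c ` S \<longleftrightarrow> x \<in> S"
  using inj_on_image_mem_iff[OF chart_inj[OF assms(1)]] assms by blast

lemma transition_apply: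
  "is_chart c \<Longrightarrow> x \<in> fst c \<Longrightarrow> transition c c' (snd c x) = snd c' x"
  by (simp add: transition_def chart_inv)

lemma is_chart_restrict:
  assumes c: "is_chart c" and V: "open V" "V \<subseteq> fst c"
  shows "is_chart (V, snd c)"
proof -
  \<comment> \<open>Off the image of \<open>V\<close> the two inverses need not agree.\<close>
  have inv: "inv_into V (snd c) z = inv_into (fst c) (snd c) z" if z: "z \<in> snd c ` V" for z
  proof -
    obtain x where x: "x \<in> V" "z = snd c x"
      using z by blast
    then show ?thesis
      using inv_into_f_f[OF inj_on_subset[OF chart_inj[OF c] V(2)]] chart_inv[OF c, of x] V(2) by auto
  qed
  have "homeomorphism (fst c) (snd c ` fst c) (snd c) (inv_into (fst c) (snd c))"
    using c unfolding is_chart_def by blast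
  then have "homeomorphism V (snd c ` V) (snd c) (inv_into (fst c) (snd c))"
    by (rule homeomorphism_of_subsets) (use V in auto)
  then have "homeomorphism V (snd c ` V) (snd c) (inv_into V (snd c))"
    by (rule homeomorphism_cong) (use inv in auto)
  then show ?thesis
    using chart_open_image[OF c V] V(1) unfolding is_chart_def by simp
qed

locale atlas =
  fixes A :: "('a::{t2_space, second_countable_topology}, 'm::finite) chart set"
  assumes atlas: "C1_atlas A"
begin

lemma atlas_subset_charts: "A \<subseteq> charts A"
  using atlas unfolding C1_atlas_def charts_def by blast

lemma is_chart: "c \<in> charts A \<Longrightarrow> is_chart c"
  unfolding charts_def by blast

lemma ex_atlas_chart: "\<exists>a\<in>A. x \<in> fst a"
  using atlas unfolding C1_atlas_def by blast

lemma ex_chart_at: "\<exists>c. c \<in> charts_at A x"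
  using ex_atlas_chart atlas_subset_charts unfolding charts_at_def by blast

lemma charts_atD: "c \<in> charts_at A x \<Longrightarrow> c \<in> charts A" "c \<in> charts_at A x \<Longrightarrow> x \<in> fst c"
  unfolding charts_at_def by auto

text \<open>By definition a chart of the maximal atlas is compatible with the members of
  \<open>A\<close> only. Near each point the transition between two such charts factors through a
  member of \<open>A\<close>, and being C^1 is a local property.\<close>

lemma transition_C1:
  assumes c: "c \<in> charts A" and c': "c' \<in> charts A"
  shows "C1_on (snd c ` (fst c \<inter> fst c')) (transition c c')"
proof (rule C1_on_locally)
  fix z assume "z \<in> snd c ` (fst c \<inter> fst c')"
  then obtain x where x: "x \<in> fst c" "x \<in> fst c'" "z = snd c x" by blast
  obtain a where a: "a \<in> A" "x \<in> fst a" using ex_atlas_chart by blast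
  let ?T = "snd c ` (fst c \<inter> fst c' \<inter> fst a)"
  have ch: "is_chart c" "is_chart c'" "is_chart a"
    using c c' subsetD[OF atlas_subset_charts a(1)] by (simp_all only: is_chart)
  have open_T: "open ?T"
    using ch by (intro chart_open_image) (auto intro: chart_open_dom)
  have "C1_on (snd c ` (fst c \<inter> fst a)) (transition c a)" "C1_on (snd a ` (fst a \<inter> fst c')) (transition a c')"
    using c c' a by (auto simp: charts_def C1_compatible_def Int_commute)
  then have "C1_on ?T (transition a c' \<circ> transition c a)"
    using ch by (intro C1_on_compose[of _ _ "snd a ` (fst a \<inter> fst c')"])
      (auto elim!: C1_on_subset simp: transition_apply)
  then have "C1_on ?T (transition c c')"
    using open_T by (rule C1_on_transform) (auto simp: transition_apply ch)
  moreover have "z \<in> ?T"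
    using x a(2) by blast
  ultimately show "\<exists>T. open T \<and> z \<in> T \<and> C1_on T (transition c c')"
    using open_T by (intro exI[of _ ?T] conjI)
qed

lemma transition_differentiable:
  assumes "c \<in> charts_at A x" "c' \<in> charts_at A x"
  shows "transition c c' differentiable (at (snd c x))"
  using assms by (intro C1_on_differentiable[OF transition_C1]) (auto simp: charts_at_def)

text \<open>Serves to replace a chart by one with bounded image, hence of finite Lebesgue measure,
  when local convergence in measure has to be established.\<close>

lemma charts_restrict:
  assumes c: "c \<in> charts A" and V: "open V" "V \<subseteq> fst c"
  shows "(V, snd c) \<in> charts A"
proof -
  have "C1_compatible (V, snd c) a" if "a \<in> A" for a
  proof -
    have ch: "is_chart c" "is_chart a" "is_chart (V, snd c)"
      using c V subsetD[OF atlas_subset_charts that] by (simp_all only: is_chart is_chart_restrict)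
    have op: "open (snd c ` (V \<inter> fst a))"
      using chart_open_image[OF ch(1), of "V \<inter> fst a"] V ch by (auto intro: chart_open_dom)
    have *: "C1_on (snd c ` (fst c \<inter> fst a)) (transition c a)" "C1_on (snd a ` (fst c \<inter> fst a)) (transition a c)"
      using c that by (auto simp: charts_def C1_compatible_def)
    have "C1_on (snd c ` (V \<inter> fst a)) (transition (V, snd c) a)"
    proof (rule C1_on_transform[OF C1_on_subset[OF *(1)] op])
      fix z assume "z \<in> snd c ` (V \<inter> fst a)"
      then obtain x where "x \<in> V" "z = snd c x" by blast
      then show "transition c a z = transition (V, snd c) a z"
        using transition_apply[OF ch(3), of x a] transition_apply[OF ch(1), of x a] V by auto
    qed (use V in auto)
    moreover have "C1_on (snd a ` (V \<inter> fst a)) (transition a (V, snd c))"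
      using C1_on_subset[OF *(2), of "snd a ` (V \<inter> fst a)"] V unfolding transition_def by auto
    ultimately show ?thesis
      by (simp add: C1_compatible_def)
  qed
  then show ?thesis
    using is_chart_restrict[OF is_chart[OF c] V] unfolding charts_def mem_Collect_eq
    by (intro conjI ballI)
qed

end


section \<open>Tangent vectors in coordinates\<close>

context atlas
begin

abbreviation dtrans :: "('a, 'm) chart \<Rightarrow> ('a, 'm) chart \<Rightarrow> 'a \<Rightarrow> real ^ 'm \<Rightarrow> real ^ 'm" where
  "dtrans c c' x \<equiv> frechet_derivative (transition c c') (at (snd c x))"

lemma open_overlap_image:
  "c \<in> charts A \<Longrightarrow> c' \<in> charts A \<Longrightarrow> open (snd c ` (fst c \<inter> fst c'))"
  by (intro chart_open_image is_chart) (auto intro: chart_open_dom is_chart)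

lemma linear_dtrans:
  "c \<in> charts_at A x \<Longrightarrow> c' \<in> charts_at A x \<Longrightarrow> linear (dtrans c c' x)"
  by (intro linear_frechet_derivative transition_differentiable)

lemma dtrans_self:
  assumes "c \<in> charts_at A x"
  shows "dtrans c c x h = h"
proof -
  have c: "is_chart c" "x \<in> fst c" "c \<in> charts A"
    using assms charts_atD is_chart by blast+
  have "frechet_derivative (\<lambda>z. z) (at (snd c x)) = dtrans c c x"
  proof (rule frechet_derivative_transform_within_open)
    show "open (snd c ` (fst c \<inter> fst c))"
      using c by (intro open_overlap_image)
    show "snd c x \<in> snd c ` (fst c \<inter> fst c)"
      using c by blast
    show "z = transition c c z" if "z \<in> snd c ` (fst c \<inter> fst c)" for z
      using that by (auto simp: transition_apply c)
  qed simp
  then show ?thesis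
    by (metis frechet_derivative_ident)
qed

text \<open>The cocycle identity of the tangent bundle, from the chain rule. The transitions compose
  to the direct one only on the image of the triple overlap, which suffices because that image is
  open.\<close>

lemma dtrans_dtrans:
  assumes c: "c \<in> charts_at A x" and c': "c' \<in> charts_at A x" and c'': "c'' \<in> charts_at A x"
  shows "dtrans c' c'' x (dtrans c c' x h) = dtrans c c'' x h"
proof -
  note ch = charts_atD[OF c] charts_atD[OF c'] charts_atD[OF c'']
  note ich = is_chart[OF ch(1)] is_chart[OF ch(3)] is_chart[OF ch(5)]
  let ?S = "snd c ` (fst c \<inter> fst c' \<inter> fst c'')"
  have eq: "transition c c' (snd c x) = snd c' x"
    using ch ich by (intro transition_apply)
  have d: "transition c c' differentiable (at (snd c x))"
    "transition c' c'' differentiable (at (transition c c' (snd c x)))"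
    using transition_differentiable[OF c c'] transition_differentiable[OF c' c''] eq by auto
  have "frechet_derivative (transition c' c'' \<circ> transition c c') (at (snd c x)) = dtrans c c'' x"
  proof (rule frechet_derivative_transform_within_open)
    show "open ?S"
      using ich by (intro chart_open_image) (auto intro: chart_open_dom)
    show "snd c x \<in> ?S"
      using ch by blast
    show "(transition c' c'' \<circ> transition c c') z = transition c c'' z" if z: "z \<in> ?S" for z
    proof -
      obtain y where "y \<in> fst c" "y \<in> fst c'" "z = snd c y" using z by blast
      then show ?thesis using ich by (simp add: transition_apply)
    qed
    show "transition c' c'' \<circ> transition c c' differentiable (at (snd c x))"
      using d by (rule differentiable_chain_at)
  qed
  then show ?thesis
    using frechet_derivative_compose[OF d] eq by (metis comp_apply)
qed

lemma coord_vector_apply: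
  "c' \<in> charts_at A x \<Longrightarrow> coord_vector A x c h c' = dtrans c c' x h"
  by (simp add: coord_vector_def)

lemma coord_vector_self: "c \<in> charts_at A x \<Longrightarrow> coord_vector A x c h c = h"
  by (simp add: coord_vector_apply dtrans_self)

lemma coord_vector_in_tangent_space:
  assumes "c \<in> charts_at A x"
  shows "coord_vector A x c h \<in> tangent_space A x"
  unfolding tangent_space_def mem_Collect_eq
proof (intro conjI allI ballI impI)
  fix c' assume "c' \<notin> charts_at A x"
  then show "coord_vector A x c h c' = 0"
    by (simp add: coord_vector_def)
next
  fix c' c'' assume "c' \<in> charts_at A x" "c'' \<in> charts_at A x"
  then show "coord_vector A x c h c'' = dtrans c' c'' x (coord_vector A x c h c')"
    using assms by (simp add: coord_vector_apply dtrans_dtrans)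
qed

lemma tangent_space_outside: "v \<in> tangent_space A x \<Longrightarrow> c \<notin> charts_at A x \<Longrightarrow> v c = 0"
  unfolding tangent_space_def mem_Collect_eq by metis

lemma tangent_space_dtrans:
  "v \<in> tangent_space A x \<Longrightarrow> c \<in> charts_at A x \<Longrightarrow> c' \<in> charts_at A x \<Longrightarrow> dtrans c c' x (v c) = v c'"
  unfolding tangent_space_def mem_Collect_eq by metis

text \<open>With \<open>coord_vector_self\<close> this makes \<open>coord_vector A x c\<close> a
  bijection from coordinate vectors onto the tangent space, inverse to evaluation at
  \<open>c\<close>.\<close>

lemma coord_vector_of_tangent:
  assumes "v \<in> tangent_space A x" "c \<in> charts_at A x"
  shows "coord_vector A x c (v c) = v"
proof
  fix c'
  show "coord_vector A x c (v c) c' = v c'"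
    using tangent_space_outside[OF assms(1)] tangent_space_dtrans[OF assms] by (simp add: coord_vector_def)
qed

lemma tangent_space_lincomb:
  assumes v: "v \<in> tangent_space A x" and w: "w \<in> tangent_space A x"
  shows "(\<lambda>c. a *\<^sub>R v c + w c) \<in> tangent_space A x"
  unfolding tangent_space_def mem_Collect_eq
proof (intro conjI allI ballI impI)
  fix c assume "c \<notin> charts_at A x"
  then show "a *\<^sub>R v c + w c = 0"
    using v w by (simp add: tangent_space_outside)
next
  fix c c' assume c: "c \<in> charts_at A x" "c' \<in> charts_at A x"
  have "v c' = dtrans c c' x (v c)" "w c' = dtrans c c' x (w c)"
    using v w c by (simp_all add: tangent_space_dtrans)
  then show "a *\<^sub>R v c' + w c' = dtrans c c' x (a *\<^sub>R v c + w c)"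
    using linear_dtrans[OF c] by (simp add: linear_add linear_scale)
qed

lemma tangent_space_zero: "(\<lambda>c. 0) \<in> tangent_space A x"
  unfolding tangent_space_def mem_Collect_eq
  by (intro conjI allI ballI impI refl linear_0[symmetric] linear_dtrans)

lemma tangent_space_add:
  "v \<in> tangent_space A x \<Longrightarrow> w \<in> tangent_space A x \<Longrightarrow> (\<lambda>c. v c + w c) \<in> tangent_space A x"
  using tangent_space_lincomb[of v x w 1] by simp

lemma tangent_space_scaleR:
  "v \<in> tangent_space A x \<Longrightarrow> (\<lambda>c. a *\<^sub>R v c) \<in> tangent_space A x"
  using tangent_space_lincomb[OF _ tangent_space_zero] by simp

lemma coord_vector_lincomb:
  assumes c: "c \<in> charts_at A x"
  shows "coord_vector A x c (a *\<^sub>R h + k) = (\<lambda>c'. a *\<^sub>R coord_vector A x c h c' + coord_vector A x c k c')"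
proof
  fix c'
  show "coord_vector A x c (a *\<^sub>R h + k) c' = a *\<^sub>R coord_vector A x c h c' + coord_vector A x c k c'"
    using linear_dtrans[OF c, of c'] by (auto simp: coord_vector_def linear_add linear_scale)
qed

lemma coord_vector_zero: "c \<in> charts_at A x \<Longrightarrow> coord_vector A x c 0 = (\<lambda>c'. 0)"
  using coord_vector_of_tangent[OF tangent_space_zero] by simp

lemma coord_vector_add:
  "c \<in> charts_at A x \<Longrightarrow> coord_vector A x c (h + k) = (\<lambda>c'. coord_vector A x c h c' + coord_vector A x c k c')"
  using coord_vector_lincomb[of c x 1 h k] by simp

lemma coord_vector_scaleR:
  "c \<in> charts_at A x \<Longrightarrow> coord_vector A x c (a *\<^sub>R h) = (\<lambda>c'. a *\<^sub>R coord_vector A x c h c')"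
  using coord_vector_lincomb[of c x a h 0] by (simp add: coord_vector_zero)

lemma coord_vector_change:
  assumes "c \<in> charts_at A x" "a \<in> charts_at A x"
  shows "coord_vector A x c h = coord_vector A x a (dtrans c a x h)"
  using coord_vector_of_tangent[OF coord_vector_in_tangent_space[OF assms(1)] assms(2), of h]
  by (simp add: coord_vector_apply assms)

end


section \<open>The bundle of linear maps\<close>

locale atlas_pair = A: atlas A + B: atlas B
  for A :: "('a::{t2_space, second_countable_topology}, 'm::finite) chart set"
    and B :: "('b::{t2_space, second_countable_topology}, 'n::finite) chart set"
begin

lemma hom_space_tangent: "\<xi> \<in> hom_space A x B y \<Longrightarrow> v \<in> tangent_space A x \<Longrightarrow> \<xi> v \<in> tangent_space B y"
  unfolding hom_space_def by blast

lemma hom_space_linear_coord: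
  assumes \<xi>: "\<xi> \<in> hom_space A x B y" and c: "c \<in> charts_at A x"
  shows "linear (\<lambda>h. \<xi> (coord_vector A x c h) c')"
proof (rule linearI)
  fix h k
  have "\<xi> (\<lambda>c'. coord_vector A x c h c' + coord_vector A x c k c') =
      (\<lambda>c'. \<xi> (coord_vector A x c h) c' + \<xi> (coord_vector A x c k) c')"
    using \<xi> A.coord_vector_in_tangent_space[OF c] unfolding hom_space_def by simp
  then show "\<xi> (coord_vector A x c (h + k)) c' = \<xi> (coord_vector A x c h) c' + \<xi> (coord_vector A x c k) c'"
    by (simp add: A.coord_vector_add[OF c])
next
  fix a h
  have "\<xi> (\<lambda>c'. a *\<^sub>R coord_vector A x c h c') = (\<lambda>c'. a *\<^sub>R \<xi> (coord_vector A x c h) c')"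
    using \<xi> A.coord_vector_in_tangent_space[OF c] unfolding hom_space_def by simp
  then show "\<xi> (coord_vector A x c (a *\<^sub>R h)) c' = a *\<^sub>R \<xi> (coord_vector A x c h) c'"
    by (simp add: A.coord_vector_scaleR[OF c])
qed

lemma triv_apply:
  assumes \<xi>: "\<xi> \<in> hom_space A x B y" and c: "c \<in> charts_at A x"
  shows "blinfun_apply (snd (snd (triv A c c' (x, y, \<xi>)))) h = \<xi> (coord_vector A x c h) c'"
proof -
  \<comment> \<open>\<open>Blinfun\<close> is meaningful on bounded linear maps only; in finite
    dimension linearity is enough.\<close>
  have "bounded_linear (\<lambda>h. \<xi> (coord_vector A x c h) c')"
    using hom_space_linear_coord[OF \<xi> c] linear_conv_bounded_linear by blast
  then show ?thesis
    by (simp add: triv_def bounded_linear_Blinfun_apply)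
qed

lemma zero_section_in_bundle: "zero_section A (x, y) \<in> hom_bundle A B"
  unfolding hom_bundle_def zero_section_def hom_space_def
  by (auto simp: A.tangent_space_add A.tangent_space_scaleR B.tangent_space_zero)

lemma hom_bundle_cases:
  assumes "e \<in> hom_bundle A B"
  obtains x y \<xi> where "e = (x, y, \<xi>)" "\<xi> \<in> hom_space A x B y" "bundle_proj e = (x, y)"
  using assms unfolding hom_bundle_def bundle_proj_def by auto

end


section \<open>The topology of the bundle\<close>

text \<open>Operators are identified with matrices, whose space has a countable base, and the base
  is pulled back along \<open>?to\<close>. Continuity of \<open>?to\<close> makes the preimages
  open; continuity of \<open>?from\<close> together with \<open>from_to\<close> makes them small
  enough.\<close>

lemma ex_countable_basis_coordinates:
  "\<exists>\<W> :: ((real ^ 'm::finite) \<times> (real ^ 'n::finite) \<times> ((real ^ 'm) \<Rightarrow>\<^sub>L (real ^ 'n))) set set.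
     countable \<W> \<and> topological_basis \<W>"
proof -
  let ?to = "\<lambda>p :: (real ^ 'm) \<times> (real ^ 'n) \<times> ((real ^ 'm) \<Rightarrow>\<^sub>L (real ^ 'n)).
    (fst p, fst (snd p), matrix (blinfun_apply (snd (snd p))))"
  let ?from = "\<lambda>p :: (real ^ 'm) \<times> (real ^ 'n) \<times> (real ^ 'm ^ 'n).
    (fst p, fst (snd p), Blinfun ((*v) (snd (snd p))))"
  have bl: "blinfun_apply (Blinfun ((*v) M)) h = M *v h" for M :: "real ^ 'm ^ 'n" and h
    by (simp add: bounded_linear_Blinfun_apply)
  have "linear (\<lambda>M :: real ^ 'm ^ 'n. Blinfun ((*v) M))"
    by (rule linearI) (auto intro!: blinfun_eqI simp: bl blinfun.bilinear_simps
        matrix_vector_mult_add_rdistrib scaleR_matrix_vector_assoc)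
  then have "continuous_on UNIV (\<lambda>M :: real ^ 'm ^ 'n. Blinfun ((*v) M))"
    using linear_continuous_on linear_conv_bounded_linear by blast
  then have cont_from: "continuous_on UNIV ?from"
    by (intro continuous_intros) (auto intro!: continuous_on_compose2[of UNIV "\<lambda>M. Blinfun ((*v) M)"] continuous_intros)
  have cont_to: "continuous_on UNIV ?to"
    unfolding matrix_def by (intro continuous_intros)
  have from_to: "?from (?to p) = p" for p
    by (auto intro!: prod_eqI blinfun_eqI simp: blinfun_apply_inverse bl matrix_works blinfun.bounded_linear_right bounded_linear.linear)
  obtain \<B> :: "((real ^ 'm) \<times> (real ^ 'n) \<times> (real ^ 'm ^ 'n)) set set"
    where \<B>: "countable \<B>" "topological_basis \<B>"
    using ex_countable_basis by blast
  have "topological_basis ((\<lambda>V. ?to -` V) ` \<B>)"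
  proof (rule topological_basisI)
    fix V assume "V \<in> (\<lambda>V. ?to -` V) ` \<B>"
    then show "open V"
      using topological_basis_open[OF \<B>(2)] open_vimage[OF _ cont_to] by blast
  next
    fix V :: "((real ^ 'm) \<times> (real ^ 'n) \<times> ((real ^ 'm) \<Rightarrow>\<^sub>L (real ^ 'n))) set" and p
    assume V: "open V" "p \<in> V"
    have "open (?from -` V)"
      using open_vimage[OF V(1) cont_from] .
    moreover have "?to p \<in> ?from -` V"
      using V(2) from_to by simp
    ultimately obtain W where W: "W \<in> \<B>" "?to p \<in> W" "W \<subseteq> ?from -` V"
      by (rule topological_basisE[OF \<B>(2)])
    have "?to -` W \<subseteq> V"
    proof
      fix q assume "q \<in> ?to -` W"
      then have "?from (?to q) \<in> V"
        using W(3) by blast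
      then show "q \<in> V"
        unfolding from_to .
    qed
    then show "\<exists>V'\<in>(\<lambda>V. ?to -` V) ` \<B>. p \<in> V' \<and> V' \<subseteq> V"
      using W by (intro bexI[of _ "?to -` W"]) auto
  qed
  then show ?thesis
    using \<B>(1) by blast
qed

text \<open>Lindelof's theorem selects countably many chart domains, and each is lifted to one chart
  that has it as domain.\<close>

lemma (in atlas) ex_countable_atlas: "\<exists>A0\<subseteq>A. countable A0 \<and> (\<forall>x. \<exists>a\<in>A0. x \<in> fst a)"
proof -
  have "open S" if "S \<in> fst ` A" for S
    using that chart_open_dom[OF is_chart] atlas_subset_charts by blast
  then obtain F where F: "F \<subseteq> fst ` A" "countable F" "\<Union>F = \<Union>(fst ` A)"
    using Lindelof[of "fst ` A"] by blast
  then obtain A0 where A0: "A0 \<subseteq> A" "countable A0" "F = fst ` A0"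
    using countable_subset_image[THEN iffD1, OF conjI[OF F(2,1)]] by (elim exE conjE)
  have "\<exists>a\<in>A0. x \<in> fst a" for x
  proof -
    obtain a where "a \<in> A" "x \<in> fst a"
      by (rule bexE[OF ex_atlas_chart])
    then have "x \<in> \<Union>(fst ` A)"
      by (rule UN_I)
    then have "x \<in> \<Union>(fst ` A0)"
      unfolding F(3)[symmetric] A0(3) .
    then show ?thesis
      by (simp only: UN_iff)
  qed
  then show ?thesis
    using A0 by (intro exI[of _ A0] conjI allI)
qed

section \<open>Change of trivialization and a countable base of the bundle\<close>

context atlas_pair
begin

text \<open>These are the generators of \<open>bundle_topology\<close>. The condition on
  \<open>bundle_proj\<close> is essential, because a chart function takes arbitrary values outside
  its domain.\<close>

definition bundle_box where
  "bundle_box a b W = {e \<in> hom_bundle A B. bundle_proj e \<in> fst a \<times> fst b \<and> triv A a b e \<in> W}"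

text \<open>The passage from the trivialization over \<open>(a, b)\<close> to the one over
  \<open>(c, c')\<close>. The operator is composed with the derivative of \<open>b\<close> to
  \<open>c'\<close> on the left and, being contravariant in the source, with that of
  \<open>c\<close> to \<open>a\<close> on the right.\<close>

definition coord_change where
  "coord_change a b c c' = (\<lambda>(z, y, L). (transition a c z, transition b c' y,
     Blinfun (frechet_derivative (transition b c') (at y)) o\<^sub>L L o\<^sub>L
     Blinfun (frechet_derivative (transition c a) (at (transition a c z)))))"

text \<open>Coordinates in \<open>c\<close> are first moved to \<open>a\<close>, the linear map is
  then read in \<open>(a, b)\<close>, and its value is moved from \<open>b\<close> to
  \<open>c'\<close>.\<close>

lemma triv_change:
  assumes e: "e \<in> hom_bundle A B" and a: "a \<in> charts A" and b: "b \<in> charts B"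
    and c: "c \<in> charts A" and c': "c' \<in> charts B"
    and p: "bundle_proj e \<in> (fst a \<inter> fst c) \<times> (fst b \<inter> fst c')"
  shows "triv A c c' e = coord_change a b c c' (triv A a b e)"
proof -
  obtain x y \<xi> where e_eq: "e = (x, y, \<xi>)" "\<xi> \<in> hom_space A x B y" "bundle_proj e = (x, y)"
    using hom_bundle_cases[OF e] by metis
  have at: "a \<in> charts_at A x" "c \<in> charts_at A x" "b \<in> charts_at B y" "c' \<in> charts_at B y"
    using p e_eq(3) a b c c' by (simp_all add: charts_at_def)
  have ac: "transition a c (snd a x) = snd c x" and bc': "transition b c' (snd b y) = snd c' y"
    using A.charts_atD(2)[OF at(1)] B.charts_atD(2)[OF at(3)]
    by (simp_all add: transition_apply A.is_chart[OF a] B.is_chart[OF b])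
  let ?L = "\<lambda>c c'. snd (snd (triv A c c' (x, y, \<xi>)))"
  have "?L c c' = Blinfun (B.dtrans b c' y) o\<^sub>L ?L a b o\<^sub>L Blinfun (A.dtrans c a x)"
  proof (rule blinfun_eqI)
    fix h
    have "?L c c' h = \<xi> (coord_vector A x c h) c'"
      by (rule triv_apply[OF e_eq(2) at(2)])
    also have "\<dots> = \<xi> (coord_vector A x a (A.dtrans c a x h)) c'"
      by (simp only: A.coord_vector_change[OF at(2,1)])
    also have "\<dots> = B.dtrans b c' y (\<xi> (coord_vector A x a (A.dtrans c a x h)) b)"
      using at by (intro B.tangent_space_dtrans[symmetric] hom_space_tangent[OF e_eq(2)]
          A.coord_vector_in_tangent_space)
    also have "\<dots> = B.dtrans b c' y (?L a b (A.dtrans c a x h))"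
      by (simp add: triv_apply[OF e_eq(2) at(1)])
    finally show "?L c c' h = (Blinfun (B.dtrans b c' y) o\<^sub>L ?L a b o\<^sub>L Blinfun (A.dtrans c a x)) h"
      using A.linear_dtrans[OF at(2,1)] B.linear_dtrans[OF at(3,4)]
      by (simp add: bounded_linear_Blinfun_apply linear_conv_bounded_linear)
  qed
  then show ?thesis
    unfolding e_eq(1) by (simp add: coord_change_def triv_def ac bc')
qed

text \<open>The operator component contains derivatives of transitions, so this is where their
  continuity enters.\<close>

lemma continuous_on_coord_change:
  assumes a: "a \<in> charts A" and b: "b \<in> charts B" and c: "c \<in> charts A" and c': "c' \<in> charts B"
  shows "continuous_on (snd a ` (fst a \<inter> fst c) \<times> snd b ` (fst b \<inter> fst c') \<times> UNIV) (coord_change a b c c')"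
proof -
  let ?S = "snd a ` (fst a \<inter> fst c)" and ?T = "snd b ` (fst b \<inter> fst c')"
  let ?Z = "?S \<times> ?T \<times> (UNIV :: ((real ^ 'm) \<Rightarrow>\<^sub>L (real ^ 'n)) set)"
  have C1: "C1_on ?S (transition a c)" "C1_on ?T (transition b c')"
    "C1_on (snd c ` (fst c \<inter> fst a)) (transition c a)"
    using A.transition_C1 B.transition_C1 a b c c' by auto
  have cont: "continuous_on ?S (transition a c)" "continuous_on ?T (transition b c')"
    using C1 by (auto intro!: continuous_at_imp_continuous_on differentiable_imp_continuous_within
        dest: C1_on_differentiable)
  have img: "transition a c ` ?S \<subseteq> snd c ` (fst c \<inter> fst a)"
    using A.is_chart[OF a] by (auto simp: transition_apply)
  have d1: "continuous_on ?T (\<lambda>y. Blinfun (frechet_derivative (transition b c') (at y)))"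
    using C1(2) by (simp add: C1_on_iff_frechet)
  have "continuous_on (snd c ` (fst c \<inter> fst a)) (\<lambda>z. Blinfun (frechet_derivative (transition c a) (at z)))"
    using C1(3) by (simp add: C1_on_iff_frechet)
  then have d2: "continuous_on ?S (\<lambda>z. Blinfun (frechet_derivative (transition c a) (at (transition a c z))))"
    by (rule continuous_on_compose2[OF _ cont(1) img])
  have fst: "continuous_on ?Z (\<lambda>p. f (fst p))" if "continuous_on ?S f"
    for f :: "_ \<Rightarrow> 'x::topological_space"
    by (rule continuous_on_compose2[OF that]) (auto intro: continuous_intros)
  have snd: "continuous_on ?Z (\<lambda>p. f (fst (snd p)))" if "continuous_on ?T f"
    for f :: "_ \<Rightarrow> 'x::topological_space"
    by (rule continuous_on_compose2[OF that]) (auto intro!: continuous_intros)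
  have "continuous_on ?Z (\<lambda>p. (transition a c (fst p), transition b c' (fst (snd p)),
     Blinfun (frechet_derivative (transition b c') (at (fst (snd p)))) o\<^sub>L snd (snd p) o\<^sub>L
     Blinfun (frechet_derivative (transition c a) (at (transition a c (fst p))))))"
    by (intro continuous_on_Pair fst[OF cont(1)] snd[OF cont(2)] fst[OF d2] snd[OF d1]
        bounded_bilinear.continuous_on[OF bounded_bilinear_blinfun_compose]
        continuous_on_snd continuous_on_id)
  then show ?thesis
    by (simp add: coord_change_def case_prod_unfold)
qed

lemma openin_bundle_box:
  "a \<in> charts A \<Longrightarrow> b \<in> charts B \<Longrightarrow> open W \<Longrightarrow> openin (bundle_topology A B) (bundle_box a b W)"
  unfolding bundle_topology_def openin_topology_generated_by_iff bundle_box_def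
  by (rule generate_topology_on.Basis) blast

text \<open>Openness near \<open>e\<close> can be tested in one fixed pair of charts around its base
  point: near \<open>e\<close> a generating box in other charts contains a box in the given ones,
  because coordinate changes are continuous. The induction carries this from generators to all open
  sets.\<close>

lemma bundle_topology_neighbourhood:
  assumes U: "openin (bundle_topology A B) U" and e: "e \<in> U"
    and a: "a \<in> charts A" and b: "b \<in> charts B" and p: "bundle_proj e \<in> fst a \<times> fst b"
  shows "\<exists>W. open W \<and> triv A a b e \<in> W \<and> bundle_box a b W \<subseteq> U"
  using U[unfolded bundle_topology_def openin_topology_generated_by_iff] e
proof (induction rule: generate_topology_on.induct)
  case Empty
  then show ?case by simp
next
  case (Int U V)
  then have "e \<in> U" "e \<in> V"
    by simp_all
  obtain W1 where "open W1" "triv A a b e \<in> W1" "bundle_box a b W1 \<subseteq> U"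
    using Int.IH(1)[OF \<open>e \<in> U\<close>] by (elim exE conjE)
  moreover obtain W2 where "open W2" "triv A a b e \<in> W2" "bundle_box a b W2 \<subseteq> V"
    using Int.IH(2)[OF \<open>e \<in> V\<close>] by (elim exE conjE)
  moreover have "bundle_box a b (W1 \<inter> W2) \<subseteq> bundle_box a b W1 \<inter> bundle_box a b W2"
    unfolding bundle_box_def by blast
  ultimately show ?case
    by (intro exI[of _ "W1 \<inter> W2"]) auto
next
  case (UN K)
  then obtain V where V: "V \<in> K" "e \<in> V"
    by (elim UnionE)
  obtain W where W: "open W" "triv A a b e \<in> W" "bundle_box a b W \<subseteq> V"
    using UN.IH[OF V] by (elim exE conjE)
  show ?case
    by (rule exI[of _ W], intro conjI) (fact W(1), fact W(2), rule subset_trans[OF W(3) Union_upper[OF V(1)]])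
next
  case (Basis U)
  then obtain c c' W where c: "c \<in> charts A" "c' \<in> charts B" "open W" and U: "U = bundle_box c c' W"
    unfolding bundle_box_def mem_Collect_eq by (elim exE conjE)
  let ?O = "snd a ` (fst a \<inter> fst c) \<times> snd b ` (fst b \<inter> fst c') \<times> (UNIV :: ((real ^ 'm) \<Rightarrow>\<^sub>L (real ^ 'n)) set)"
  \<comment> \<open>The coordinate form of the generator \<open>U\<close>, seen in
    \<open>(a, b)\<close> and cut down to the overlap, where \<open>coord_change\<close> is
    continuous.\<close>
  let ?W = "?O \<inter> coord_change a b c c' -` W"
  have "open ?O"
    by (intro open_Times A.open_overlap_image B.open_overlap_image open_UNIV a b c)
  then have "open ?W"
    using continuous_on_coord_change[OF a b c(1,2)] c(3) by (simp add: continuous_on_open_vimage Int_commute)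
  moreover have "triv A a b e \<in> ?W"
  proof -
    have eU: "e \<in> hom_bundle A B" "bundle_proj e \<in> fst c \<times> fst c'" "triv A c c' e \<in> W"
      using \<open>e \<in> U\<close> unfolding U bundle_box_def by auto
    then have p': "bundle_proj e \<in> (fst a \<inter> fst c) \<times> (fst b \<inter> fst c')"
      using p by auto
    have "triv A a b e \<in> ?O"
      using p' unfolding triv_def bundle_proj_def by (auto split: prod.splits)
    then show ?thesis
      using eU(3) triv_change[OF eU(1) a b c(1,2) p'] by simp
  qed
  moreover have "bundle_box a b ?W \<subseteq> U"
  proof
    fix e' assume "e' \<in> bundle_box a b ?W"
    then have e': "e' \<in> hom_bundle A B" "bundle_proj e' \<in> fst a \<times> fst b" "triv A a b e' \<in> ?O"
      "coord_change a b c c' (triv A a b e') \<in> W"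
      unfolding bundle_box_def by auto
    \<comment> \<open>Only the coordinates are known to lie in the images of the overlaps;
      injectivity of the charts brings this back to the base points.\<close>
    have "snd a (fst e') \<in> snd a ` (fst a \<inter> fst c)" "snd b (fst (snd e')) \<in> snd b ` (fst b \<inter> fst c')"
      using e'(3) unfolding triv_def by (auto split: prod.splits)
    then have p': "bundle_proj e' \<in> (fst a \<inter> fst c) \<times> (fst b \<inter> fst c')"
      using e'(2) chart_image_iff[OF A.is_chart[OF a], of "fst e'" "fst a \<inter> fst c"]
        chart_image_iff[OF B.is_chart[OF b], of "fst (snd e')" "fst b \<inter> fst c'"]
      unfolding bundle_proj_def by auto
    then show "e' \<in> U"
      using e'(1,4) triv_change[OF e'(1) a b c(1,2) p'] unfolding U bundle_box_def by auto
  qed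
  ultimately show ?case
    by (intro exI[of _ ?W] conjI)
qed

lemma bundle_topology_subset: "openin (bundle_topology A B) U \<Longrightarrow> U \<subseteq> hom_bundle A B"
proof -
  assume "openin (bundle_topology A B) U"
  then have "U \<subseteq> topspace (bundle_topology A B)"
    by (rule openin_subset)
  also have "\<dots> \<subseteq> hom_bundle A B"
    unfolding bundle_topology_def topology_generated_by_topspace by blast
  finally show ?thesis .
qed

text \<open>Boxes over countable subatlases, with \<open>W\<close> from a countable base of the
  coordinate space. This countability is used twice: for almost everywhere convergence of a
  subsequence and for the measurability of distances.\<close>

lemma ex_countable_base_bundle:
  "\<exists>\<G>. countable \<G> \<and> (\<forall>G\<in>\<G>. openin (bundle_topology A B) G) \<and>
     (\<forall>U e. openin (bundle_topology A B) U \<longrightarrow> e \<in> U \<longrightarrow> (\<exists>G\<in>\<G>. e \<in> G \<and> G \<subseteq> U))"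
proof -
  obtain A0 where A0: "A0 \<subseteq> A" "countable A0" "\<And>x. \<exists>a\<in>A0. x \<in> fst a"
    using A.ex_countable_atlas by metis
  obtain B0 where B0: "B0 \<subseteq> B" "countable B0" "\<And>y. \<exists>b\<in>B0. y \<in> fst b"
    using B.ex_countable_atlas by metis
  obtain \<W> :: "((real ^ 'm) \<times> (real ^ 'n) \<times> ((real ^ 'm) \<Rightarrow>\<^sub>L (real ^ 'n))) set set"
    where \<W>: "countable \<W>" "topological_basis \<W>"
    using ex_countable_basis_coordinates by metis
  let ?\<G> = "(\<lambda>(a, b, W). bundle_box a b W) ` (A0 \<times> B0 \<times> \<W>)"
  have "countable ?\<G>"
    using A0 B0 \<W> by blast
  moreover have "openin (bundle_topology A B) G" if G: "G \<in> ?\<G>" for G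
  proof -
    obtain t where t: "t \<in> A0 \<times> B0 \<times> \<W>" "G = (\<lambda>(a, b, W). bundle_box a b W) t"
      using G by (elim imageE)
    obtain a b W where "t = (a, b, W)"
      by (rule prod_cases3)
    with t have "a \<in> A0" "b \<in> B0" "W \<in> \<W>" "G = bundle_box a b W"
      by simp_all
    then show ?thesis
      using subsetD[OF A0(1)] subsetD[OF B0(1)] subsetD[OF A.atlas_subset_charts]
        subsetD[OF B.atlas_subset_charts] topological_basis_open[OF \<W>(2)]
      by (simp only: openin_bundle_box)
  qed
  moreover have "\<exists>G\<in>?\<G>. e \<in> G \<and> G \<subseteq> U" if U: "openin (bundle_topology A B) U" and e: "e \<in> U" for U e
  proof -
    obtain a b where a: "a \<in> A0" "fst e \<in> fst a" and b: "b \<in> B0" "fst (snd e) \<in> fst b"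
      using A0(3) B0(3) by metis
    have ch: "a \<in> charts A" "b \<in> charts B"
      using a b A0(1) B0(1) A.atlas_subset_charts B.atlas_subset_charts by blast+
    have p: "bundle_proj e \<in> fst a \<times> fst b"
      using a b by (simp add: bundle_proj_def)
    obtain W where W: "open W" "triv A a b e \<in> W" "bundle_box a b W \<subseteq> U"
      using bundle_topology_neighbourhood[OF U e ch p] by metis
    obtain W' where W': "W' \<in> \<W>" "triv A a b e \<in> W'" "W' \<subseteq> W"
      by (rule topological_basisE[OF \<W>(2) W(1,2)])
    have "e \<in> bundle_box a b W'"
      using W'(2) p subsetD[OF bundle_topology_subset[OF U] e] by (simp add: bundle_box_def)
    moreover have "bundle_box a b W' \<subseteq> bundle_box a b W"
      using W'(3) unfolding bundle_box_def by blast
    then have "bundle_box a b W' \<subseteq> U"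
      using W(3) by (rule subset_trans)
    moreover have "bundle_box a b W' \<in> ?\<G>"
      using a b W' by (intro image_eqI[of _ _ "(a, b, W')"]) simp_all
    ultimately show ?thesis
      by (intro bexI[of _ "bundle_box a b W'"] conjI)
  qed
  ultimately show ?thesis
    by (intro exI[of _ ?\<G>] conjI ballI allI impI)
qed

end


section \<open>The Riemannian measure\<close>

lemma linear_axis_expansion:
  fixes f :: "real ^ 'm \<Rightarrow> 'v::real_vector"
  assumes "linear f"
  shows "f h = (\<Sum>i\<in>UNIV. h $ i *\<^sub>R f (axis i 1))"
proof -
  have "f h = f (\<Sum>i\<in>UNIV. h $ i *\<^sub>R axis i 1)"
    using basis_expansion[of h] by (simp add: scalar_mult_eq_scaleR)
  then show ?thesis
    by (simp add: linear_sum[OF assms] linear_scale[OF assms])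
qed

lemma image_UN_Int: "f ` ((\<Union>k. F k) \<inter> X) = (\<Union>k. f ` (F k \<inter> X))"
  by blast

lemma continuous_on_det:
  fixes M :: "'t::topological_space \<Rightarrow> real ^ 'm ^ 'm"
  assumes "\<And>i j. continuous_on S (\<lambda>t. M t $ i $ j)"
  shows "continuous_on S (\<lambda>t. det (M t))"
  unfolding det_def by (intro continuous_intros assms)

text \<open>The determinant does not vanish along the segment from the identity to a positive definite matrix.\<close>

lemma det_pos_of_positive_definite:
  fixes G :: "real ^ 'm ^ 'm"
  assumes pos: "\<And>v. v \<noteq> 0 \<Longrightarrow> v \<bullet> (G *v v) > 0"
  shows "det G > 0"
proof (rule ccontr)
  assume neg: "\<not> det G > 0"
  define M where "M t = (1 - t) *\<^sub>R mat 1 + t *\<^sub>R G" for t :: real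
  have "continuous_on {0..1} (\<lambda>t. det (M t))"
    by (intro continuous_on_det) (auto simp: M_def intro!: continuous_intros)
  moreover have "det (M 1) \<le> 0" "0 \<le> det (M 0)"
    using neg by (auto simp: M_def)
  ultimately obtain t where t: "0 \<le> t" "t \<le> 1" "det (M t) = 0"
    using IVT2'[of "\<lambda>t. det (M t)" 1 0 0] by auto
  \<comment> \<open>A nonzero kernel vector would give the value 0 to a convex combination of the
    positive numbers \<open>v \<bullet> v\<close> and \<open>v \<bullet> (G *v v)\<close>.\<close>
  have "v = 0" if v: "M t *v v = 0" for v
  proof (rule ccontr)
    assume "v \<noteq> 0"
    have "v \<bullet> (M t *v v) = (1 - t) * (v \<bullet> v) + t * (v \<bullet> (G *v v))"
      by (simp add: M_def matrix_vector_mult_add_rdistrib scaleR_matrix_vector_assoc[symmetric] inner_add_right)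
    also have "\<dots> > 0"
    proof (cases "t = 0")
      case False
      then have "t * (v \<bullet> (G *v v)) > 0"
        using t pos[OF \<open>v \<noteq> 0\<close>] by simp
      then show ?thesis
        using t by (intro add_nonneg_pos) auto
    qed (use \<open>v \<noteq> 0\<close> in simp)
    finally show False
      using v by simp
  qed
  then have "\<exists>N. N ** M t = mat 1"
    using matrix_left_invertible_ker[of "M t"] by simp
  then have "invertible (M t)"
    by (simp add: invertible_left_inverse)
  then show False
    using t by (simp add: invertible_det_nz)
qed

section \<open>Gram matrices and the volume density in charts\<close>

locale riemannian = atlas A
  for A :: "('a::{t2_space, second_countable_topology}, 'm::finite) chart set" +
  fixes g :: "('a, 'm) metric_tensor"
  assumes metric: "riemannian_metric A g"
begin

lemma metric_sym:
  "v \<in> tangent_space A x \<Longrightarrow> w \<in> tangent_space A x \<Longrightarrow> g x v w = g x w v"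
  using metric unfolding riemannian_metric_def by blast

lemma metric_lincomb_left:
  "u \<in> tangent_space A x \<Longrightarrow> v \<in> tangent_space A x \<Longrightarrow> w \<in> tangent_space A x \<Longrightarrow>
     g x (\<lambda>c. a *\<^sub>R u c + v c) w = a * g x u w + g x v w"
  using metric unfolding riemannian_metric_def by blast

lemma metric_pos: "v \<in> tangent_space A x \<Longrightarrow> v \<noteq> (\<lambda>c. 0) \<Longrightarrow> g x v v > 0"
  using metric unfolding riemannian_metric_def by blast

lemma metric_continuous:
  "c \<in> charts A \<Longrightarrow> continuous_on (fst c) (\<lambda>x. g x (coord_vector A x c h) (coord_vector A x c k))"
  using metric unfolding riemannian_metric_def by blast

lemma metric_coord_sym:
  "c \<in> charts_at A x \<Longrightarrow>
     g x (coord_vector A x c h) (coord_vector A x c k) = g x (coord_vector A x c k) (coord_vector A x c h)"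
  by (intro metric_sym coord_vector_in_tangent_space)

lemma linear_metric_coord_left:
  assumes c: "c \<in> charts_at A x"
  shows "linear (\<lambda>h. g x (coord_vector A x c h) (coord_vector A x c k))"
proof -
  have *: "g x (coord_vector A x c (a *\<^sub>R h + h')) (coord_vector A x c k) =
      a * g x (coord_vector A x c h) (coord_vector A x c k) + g x (coord_vector A x c h') (coord_vector A x c k)"
    for a h h'
    unfolding coord_vector_lincomb[OF c]
    by (intro metric_lincomb_left coord_vector_in_tangent_space c)
  have zero: "g x (coord_vector A x c 0) (coord_vector A x c k) = 0"
    using *[of 1 0 0] by simp
  show ?thesis
    using *[of 1] *[of _ _ 0] zero by (intro linearI) simp_all
qed

lemma linear_metric_coord_right:
  assumes c: "c \<in> charts_at A x"
  shows "linear (\<lambda>k. g x (coord_vector A x c h) (coord_vector A x c k))"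
  by (subst metric_coord_sym[OF c]) (rule linear_metric_coord_left[OF c])

lemma metric_coord_expansion:
  assumes c: "c \<in> charts_at A x"
  shows "g x (coord_vector A x c h) (coord_vector A x c k) =
    (\<Sum>i\<in>UNIV. \<Sum>j\<in>UNIV. h $ i * k $ j * gram_matrix A g c x $ i $ j)"
proof -
  have "g x (coord_vector A x c h) (coord_vector A x c k) =
      (\<Sum>i\<in>UNIV. h $ i *\<^sub>R g x (coord_vector A x c (axis i 1)) (coord_vector A x c k))"
    by (rule linear_axis_expansion[OF linear_metric_coord_left[OF c]])
  also have "\<dots> = (\<Sum>i\<in>UNIV. h $ i *\<^sub>R (\<Sum>j\<in>UNIV. k $ j *\<^sub>R gram_matrix A g c x $ i $ j))"
    by (subst linear_axis_expansion[OF linear_metric_coord_right[OF c]]) (simp add: gram_matrix_def)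
  finally show ?thesis
    by (simp add: sum_distrib_left mult.assoc)
qed

lemma gram_matrix_det_pos:
  assumes c: "c \<in> charts_at A x"
  shows "det (gram_matrix A g c x) > 0"
proof (rule det_pos_of_positive_definite)
  fix v :: "real ^ 'm" assume "v \<noteq> 0"
  have "coord_vector A x c v \<noteq> (\<lambda>c'. 0)"
  proof
    assume "coord_vector A x c v = (\<lambda>c'. 0)"
    then have "coord_vector A x c v c = 0"
      by simp
    then show False
      using \<open>v \<noteq> 0\<close> by (simp add: coord_vector_self[OF c])
  qed
  then have "0 < g x (coord_vector A x c v) (coord_vector A x c v)"
    by (intro metric_pos coord_vector_in_tangent_space c)
  also have "\<dots> = v \<bullet> (gram_matrix A g c x *v v)"
    unfolding metric_coord_expansion[OF c]
    by (simp add: inner_vec_def matrix_vector_mult_def sum_distrib_left mult_ac)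
  finally show "0 < v \<bullet> (gram_matrix A g c x *v v)" .
qed

lemma gram_matrix_continuous:
  "c \<in> charts A \<Longrightarrow> continuous_on (fst c) (\<lambda>x. gram_matrix A g c x $ i $ j)"
  by (simp add: gram_matrix_def metric_continuous)

definition chart_density :: "('a, 'm) chart \<Rightarrow> real ^ 'm \<Rightarrow> real" where
  "chart_density c z = sqrt (det (gram_matrix A g c (inv_into (fst c) (snd c) z)))"

text \<open>Strict positivity is what allows null sets of the Riemannian measure to be recognised as
  Lebesgue null sets in charts.\<close>

lemma chart_density_pos:
  assumes c: "c \<in> charts A" and z: "z \<in> snd c ` fst c"
  shows "chart_density c z > 0"
proof -
  obtain x where x: "x \<in> fst c" "z = snd c x"
    using z by (elim imageE)
  then have "c \<in> charts_at A x"
    using c by (simp add: charts_at_def)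
  then show ?thesis
    using x by (simp add: chart_density_def chart_inv[OF is_chart[OF c]] gram_matrix_det_pos)
qed

lemma chart_density_continuous:
  assumes c: "c \<in> charts A"
  shows "continuous_on (snd c ` fst c) (chart_density c)"
proof -
  have "continuous_on (fst c) (\<lambda>x. sqrt (det (gram_matrix A g c x)))"
    by (intro continuous_on_real_sqrt continuous_on_det gram_matrix_continuous c)
  then show ?thesis
    unfolding chart_density_def
    by (rule continuous_on_compose2[OF _ chart_inv_continuous[OF is_chart[OF c]]])
      (auto intro: inv_into_into)
qed

text \<open>Off the image of \<open>c\<close> the density formula is uncontrolled. It is therefore
  first cut off by the indicator of that open image, where it is continuous, and only then
  restricted to \<open>S\<close>.\<close>

lemma chart_density_measurable:
  assumes c: "c \<in> charts A" and S: "S \<in> sets lebesgue" "S \<subseteq> snd c ` fst c"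
  shows "(\<lambda>z. ennreal (chart_density c z) * indicator S z) \<in> borel_measurable lebesgue"
proof -
  have "open (snd c ` fst c)"
    using is_chart[OF c] unfolding is_chart_def by (elim conjE)
  then have "(\<lambda>z. indicator (snd c ` fst c) z *\<^sub>R chart_density c z) \<in> borel_measurable borel"
    by (intro borel_measurable_continuous_on_indicator chart_density_continuous c) simp
  then have "(\<lambda>z. indicator (snd c ` fst c) z *\<^sub>R chart_density c z) \<in> borel_measurable lebesgue"
    by (intro measurable_completion) (simp add: measurable_lborel2)
  then have "(\<lambda>z. ennreal (indicator (snd c ` fst c) z *\<^sub>R chart_density c z) * indicator S z)
      \<in> borel_measurable lebesgue"
    using S(1) by measurable
  moreover have "ennreal (indicator (snd c ` fst c) z *\<^sub>R chart_density c z) * indicator S z =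
      ennreal (chart_density c z) * indicator S z" for z
    using S(2) by (auto simp: indicator_def)
  ultimately show ?thesis
    by simp
qed

end

section \<open>Measurable sets and the disjoint pieces of a countable chart cover\<close>

context atlas
begin

text \<open>Charts are injective, so images under them commute with differences as well as with
  unions, and the axioms pass over from the Lebesgue sets.\<close>

lemma sigma_algebra_meas_sets: "sigma_algebra UNIV (meas_sets A)"
  unfolding sigma_algebra_iff2
proof (intro conjI ballI allI impI)
  show "meas_sets A \<subseteq> Pow UNIV" by simp
  show "{} \<in> meas_sets A" by (simp add: meas_sets_def)
next
  fix S assume S: "S \<in> meas_sets A"
  show "UNIV - S \<in> meas_sets A"
    unfolding meas_sets_def mem_Collect_eq
  proof
    fix c assume c: "c \<in> charts A"
    have "snd c ` ((UNIV - S) \<inter> fst c) = snd c ` (fst c - S \<inter> fst c)"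
      by (rule arg_cong[where f = "image (snd c)"]) blast
    also have "\<dots> = snd c ` fst c - snd c ` (S \<inter> fst c)"
      by (rule inj_on_image_set_diff[OF chart_inj[OF is_chart[OF c]]]) auto
    also have "\<dots> \<in> sets lebesgue"
    proof (rule sets.Diff)
      show "snd c ` fst c \<in> sets lebesgue"
        using is_chart[OF c] unfolding is_chart_def by (simp add: borel_open)
      show "snd c ` (S \<inter> fst c) \<in> sets lebesgue"
        using S c by (simp add: meas_sets_def)
    qed
    finally show "snd c ` ((UNIV - S) \<inter> fst c) \<in> sets lebesgue" .
  qed
next
  fix F :: "nat \<Rightarrow> 'a set" assume F: "range F \<subseteq> meas_sets A"
  show "(\<Union>i. F i) \<in> meas_sets A"
    unfolding meas_sets_def mem_Collect_eq
  proof
    fix c assume c: "c \<in> charts A"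
    have "snd c ` (F i \<inter> fst c) \<in> sets lebesgue" for i
      using subsetD[OF F, of "F i"] c by (simp add: meas_sets_def)
    then have "(\<Union>i. snd c ` (F i \<inter> fst c)) \<in> sets lebesgue"
      by (intro sets.countable_UN) (simp add: image_subset_iff)
    moreover have "snd c ` ((\<Union>i. F i) \<inter> fst c) = (\<Union>i. snd c ` (F i \<inter> fst c))"
      by (rule image_UN_Int)
    ultimately show "snd c ` ((\<Union>i. F i) \<inter> fst c) \<in> sets lebesgue"
      by (simp only:)
  qed
qed

lemma meas_sets_image: "S \<in> meas_sets A \<Longrightarrow> c \<in> charts A \<Longrightarrow> snd c ` (S \<inter> fst c) \<in> sets lebesgue"
  by (simp add: meas_sets_def)

lemma open_in_meas_sets:
  assumes "open S"
  shows "S \<in> meas_sets A"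
  unfolding meas_sets_def mem_Collect_eq
proof
  fix c assume "c \<in> charts A"
  then have "is_chart c"
    by (rule is_chart)
  then have "open (snd c ` (S \<inter> fst c))"
    using assms by (intro chart_open_image open_Int chart_open_dom) auto
  then show "snd c ` (S \<inter> fst c) \<in> sets lebesgue"
    by (simp add: borel_open)
qed

text \<open>The choice in \<open>chart_seq\<close> is witnessed by an enumeration of a countable
  subatlas, possibly with repetitions.\<close>

lemma chart_seq: "chart_seq A i \<in> charts A" "\<exists>i. x \<in> fst (chart_seq A i)"
proof -
  obtain A0 where A0: "A0 \<subseteq> A" "countable A0" "\<And>x. \<exists>a\<in>A0. x \<in> fst a"
    using ex_countable_atlas by (elim exE conjE) simp
  have "A0 \<noteq> {}"
    using A0(3) by blast
  then have r: "range (from_nat_into A0) = A0"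
    using A0(2) by (simp add: range_from_nat_into)
  have "range (from_nat_into A0) \<subseteq> charts A \<and> (\<Union>i. fst (from_nat_into A0 i)) = UNIV"
  proof
    show "range (from_nat_into A0) \<subseteq> charts A"
      using A0(1) atlas_subset_charts unfolding r by (rule subset_trans)
    have "x \<in> (\<Union>i. fst (from_nat_into A0 i))" for x
    proof -
      obtain a where "a \<in> A0" "x \<in> fst a"
        by (rule bexE[OF A0(3)])
      moreover have "a \<in> range (from_nat_into A0)"
        using \<open>a \<in> A0\<close> by (simp only: r)
      then obtain i where "a = from_nat_into A0 i"
        by (rule rangeE)
      ultimately show ?thesis
        by (intro UN_I[of i]) simp_all
    qed
    then show "(\<Union>i. fst (from_nat_into A0 i)) = UNIV"
      by (intro equalityI subset_UNIV subsetI)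
  qed
  then have *: "range (chart_seq A) \<subseteq> charts A \<and> (\<Union>i. fst (chart_seq A i)) = UNIV"
    unfolding chart_seq_def
    by (rule someI[of "\<lambda>c. range c \<subseteq> charts A \<and> (\<Union>i. fst (c i)) = UNIV"])
  then show "chart_seq A i \<in> charts A"
    by (simp add: image_subset_iff)
  have "x \<in> (\<Union>i. fst (chart_seq A i))"
    using * by simp
  then show "\<exists>i. x \<in> fst (chart_seq A i)"
    by simp
qed

definition chart_piece :: "nat \<Rightarrow> 'a set" where
  "chart_piece = disjointed (\<lambda>j. fst (chart_seq A j))"

lemma chart_piece_subset: "chart_piece i \<subseteq> fst (chart_seq A i)"
  unfolding chart_piece_def by (rule disjointed_subset)

lemma chart_piece_cover: "\<exists>i. x \<in> chart_piece i"
proof -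
  have "x \<in> (\<Union>i. fst (chart_seq A i))"
    using chart_seq(2) by simp
  then have "x \<in> (\<Union>i. chart_piece i)"
    unfolding chart_piece_def by (simp only: UN_disjointed_eq)
  then show ?thesis
    by simp
qed

lemma chart_piece_meas: "S \<in> meas_sets A \<Longrightarrow> S \<inter> chart_piece i \<in> meas_sets A"
proof -
  interpret sigma_algebra UNIV "meas_sets A"
    by (rule sigma_algebra_meas_sets)
  have "range (\<lambda>j. fst (chart_seq A j)) \<subseteq> meas_sets A"
    using chart_open_dom[OF is_chart[OF chart_seq(1)]] by (auto intro: open_in_meas_sets)
  then have "range chart_piece \<subseteq> meas_sets A"
    unfolding chart_piece_def by (rule range_disjointed_sets)
  then show "S \<in> meas_sets A \<Longrightarrow> S \<inter> chart_piece i \<in> meas_sets A"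
    by (intro Int) (simp_all add: image_subset_iff)
qed

lemma chart_piece_image_meas:
  assumes "S \<in> meas_sets A"
  shows "snd (chart_seq A i) ` (S \<inter> chart_piece i) \<in> sets lebesgue"
proof -
  have "S \<inter> chart_piece i \<inter> fst (chart_seq A i) = S \<inter> chart_piece i"
    using chart_piece_subset by blast
  then show ?thesis
    using meas_sets_image[OF chart_piece_meas[OF assms] chart_seq(1), of i i] by simp
qed

end

section \<open>The Riemannian measure as a sum over chart pieces\<close>

context riemannian
begin

definition piece_measure :: "nat \<Rightarrow> 'a set \<Rightarrow> ennreal" where
  "piece_measure i S = (\<integral>\<^sup>+ z. ennreal (chart_density (chart_seq A i) z) *
     indicator (snd (chart_seq A i) ` (S \<inter> chart_piece i)) z \<partial>lebesgue)"

lemma riemannian_measure_eq: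
  "riemannian_measure A g = measure_of UNIV (meas_sets A) (\<lambda>S. \<Sum>i. piece_measure i S)"
  by (simp add: riemannian_measure_def piece_measure_def chart_density_def chart_piece_def Let_def)

lemma piece_integrand_measurable:
  assumes "S \<in> meas_sets A"
  shows "(\<lambda>z. ennreal (chart_density (chart_seq A i) z) *
     indicator (snd (chart_seq A i) ` (S \<inter> chart_piece i)) z) \<in> borel_measurable lebesgue"
  using chart_piece_subset[of i]
  by (intro chart_density_measurable chart_piece_image_meas chart_seq(1) assms image_mono) blast

text \<open>Injectivity of the chart keeps the images of the \<open>F k\<close> disjoint, so the
  indicator of the union is the sum of the indicators and can be integrated term by term.\<close>

lemma piece_measure_countably_additive:
  assumes F: "range F \<subseteq> meas_sets A" "disjoint_family F"
  shows "piece_measure i (\<Union>k. F k) = (\<Sum>k. piece_measure i (F k))"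
proof -
  let ?c = "chart_seq A i"
  let ?I = "\<lambda>k. snd ?c ` (F k \<inter> chart_piece i)"
  let ?f = "\<lambda>k z. ennreal (chart_density ?c z) * indicator (?I k) z"
  have dis: "disjoint_family ?I"
    unfolding disjoint_family_on_def
  proof (intro ballI impI)
    fix k l :: nat assume "k \<noteq> l"
    then have "F k \<inter> F l = {}"
      using F(2) by (simp add: disjoint_family_on_def)
    moreover have "?I k \<inter> ?I l = snd ?c ` ((F k \<inter> chart_piece i) \<inter> (F l \<inter> chart_piece i))"
      using chart_piece_subset[of i]
      by (intro chart_image_Int[symmetric] is_chart chart_seq(1)) blast+
    moreover have "(F k \<inter> chart_piece i) \<inter> (F l \<inter> chart_piece i) = F k \<inter> F l \<inter> chart_piece i"
      by blast
    ultimately show "?I k \<inter> ?I l = {}"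
      by simp
  qed
  have un: "snd ?c ` ((\<Union>k. F k) \<inter> chart_piece i) = (\<Union>k. ?I k)"
    by (rule image_UN_Int)
  have ind: "ennreal (chart_density ?c z) * indicator (\<Union>k. ?I k) z = (\<Sum>k. ?f k z)" for z
    by (simp only: suminf_indicator[OF dis] ennreal_suminf_cmult)
  have "piece_measure i (\<Union>k. F k) = (\<integral>\<^sup>+ z. (\<Sum>k. ?f k z) \<partial>lebesgue)"
    unfolding piece_measure_def un by (simp only: ind)
  also have "\<dots> = (\<Sum>k. \<integral>\<^sup>+ z. ?f k z \<partial>lebesgue)"
    using F(1) by (intro nn_integral_suminf piece_integrand_measurable) (simp add: image_subset_iff)
  finally show ?thesis
    by (simp add: piece_measure_def)
qed

lemma space_riemannian_measure [simp]: "space (riemannian_measure A g) = UNIV"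
  unfolding riemannian_measure_eq by (rule space_measure_of) simp

lemma sets_riemannian_measure: "sets (riemannian_measure A g) = meas_sets A"
proof -
  interpret sigma_algebra UNIV "meas_sets A"
    by (rule sigma_algebra_meas_sets)
  show ?thesis
    unfolding riemannian_measure_eq by (simp add: sigma_sets_eq)
qed

text \<open>\<open>measure_of\<close> returns the given set function only if it is a measure.
  Additivity exchanges two sums of nonnegative terms, one of them written as an integral over
  counting measure.\<close>

lemma emeasure_riemannian_measure:
  assumes "S \<in> meas_sets A"
  shows "emeasure (riemannian_measure A g) S = (\<Sum>i. piece_measure i S)"
  unfolding riemannian_measure_eq
proof (rule emeasure_measure_of_sigma[OF sigma_algebra_meas_sets _ _ assms])
  show "positive (meas_sets A) (\<lambda>S. \<Sum>i. piece_measure i S)"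
    by (simp add: positive_def piece_measure_def)
  show "countably_additive (meas_sets A) (\<lambda>S. \<Sum>i. piece_measure i S)"
  proof (rule countably_additiveI)
    fix F :: "nat \<Rightarrow> 'a set" assume F: "range F \<subseteq> meas_sets A" "disjoint_family F"
    have "(\<Sum>k. \<Sum>i. piece_measure i (F k)) = (\<Sum>k. \<integral>\<^sup>+ i. piece_measure i (F k) \<partial>count_space UNIV)"
      by (simp only: nn_integral_count_space_nat)
    also have "\<dots> = (\<integral>\<^sup>+ i. (\<Sum>k. piece_measure i (F k)) \<partial>count_space UNIV)"
      by (rule nn_integral_suminf[symmetric]) simp
    also have "\<dots> = (\<Sum>i. \<Sum>k. piece_measure i (F k))"
      by (rule nn_integral_count_space_nat)
    finally show "(\<Sum>k. \<Sum>i. piece_measure i (F k)) = (\<Sum>i. piece_measure i (\<Union>k. F k))"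
      by (simp add: piece_measure_countably_additive[OF F])
  qed
qed

text \<open>A series of nonnegative terms vanishes iff every term does, and a strictly positive
  density has integral 0 exactly over Lebesgue null sets.\<close>

lemma emeasure_riemannian_measure_eq_0_iff:
  assumes S: "S \<in> meas_sets A"
  shows "emeasure (riemannian_measure A g) S = 0 \<longleftrightarrow>
    (\<forall>i. negligible (snd (chart_seq A i) ` (S \<inter> chart_piece i)))"
proof -
  have "piece_measure i S = 0 \<longleftrightarrow> negligible (snd (chart_seq A i) ` (S \<inter> chart_piece i))" for i
  proof -
    let ?c = "chart_seq A i" and ?I = "snd (chart_seq A i) ` (S \<inter> chart_piece i)"
    have pos: "z \<in> ?I \<Longrightarrow> chart_density ?c z > 0" for z
      using chart_piece_subset[of i]
      by (intro chart_density_pos chart_seq(1)) (erule subsetD[rotated], intro image_mono, blast)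
    have "piece_measure i S = 0 \<longleftrightarrow> (AE z in lebesgue. ennreal (chart_density ?c z) * indicator ?I z = 0)"
      unfolding piece_measure_def by (rule nn_integral_0_iff_AE[OF piece_integrand_measurable[OF S]])
    also have "\<dots> \<longleftrightarrow> (AE z in lebesgue. z \<notin> ?I)"
    proof (rule AE_cong)
      fix z
      show "ennreal (chart_density ?c z) * indicator ?I z = 0 \<longleftrightarrow> z \<notin> ?I"
        using pos[of z] by (cases "z \<in> ?I") simp_all
    qed
    also have "\<dots> \<longleftrightarrow> negligible ?I"
      using AE_iff_null[of lebesgue "\<lambda>z. z \<notin> ?I"] chart_piece_image_meas[OF S]
      by (simp add: negligible_iff_null_sets)
    finally show ?thesis .
  qed
  moreover have "(\<Sum>i. piece_measure i S) = 0 \<longleftrightarrow> (\<forall>i. piece_measure i S = 0)"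
    by (rule suminf_eq_zero_iff) simp_all
  ultimately show ?thesis
    unfolding emeasure_riemannian_measure[OF S] by (simp only:)
qed

end


section \<open>Null sets\<close>

text \<open>In \<open>c\<close> the set is a countable union of images of null sets under C^1
  transitions. The \<open>T i\<close> are kept apart from the chart domains so that the lemma serves
  both the disjoint pieces behind \<open>riemannian_measure\<close> and covers by whole
  charts.\<close>

lemma (in atlas) negligible_chart_image:
  fixes e :: "nat \<Rightarrow> ('a, 'm) chart"
  assumes e: "\<And>i. e i \<in> charts A" and T: "\<And>i. T i \<subseteq> fst (e i)" "\<And>x. \<exists>i. x \<in> T i"
    and neg: "\<And>i. negligible (snd (e i) ` (N \<inter> T i))" and c: "c \<in> charts A"
  shows "negligible (snd c ` (N \<inter> fst c))"
proof (rule negligible_subset)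
  let ?I = "\<lambda>i. snd (e i) ` (N \<inter> T i \<inter> fst c)"
  have "negligible (transition (e i) c ` ?I i)" for i
  proof (rule C1_on_negligible_image)
    have "?I i \<subseteq> snd (e i) ` (fst (e i) \<inter> fst c)"
      using T(1)[of i] by (intro image_mono) blast
    then show "C1_on (?I i) (transition (e i) c)"
      by (rule C1_on_subset[OF transition_C1[OF e c]])
    show "negligible (?I i)"
      by (rule negligible_subset[OF neg[of i]]) (intro image_mono, blast)
  qed
  then show "negligible (\<Union>i. transition (e i) c ` ?I i)"
    by (rule negligible_Union_nat)
  show "snd c ` (N \<inter> fst c) \<subseteq> (\<Union>i. transition (e i) c ` ?I i)"
  proof (rule image_subsetI)
    fix x assume x: "x \<in> N \<inter> fst c"
    obtain i where i: "x \<in> T i"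
      using T(2) by (rule exE)
    have "snd c x = transition (e i) c (snd (e i) x)"
      using subsetD[OF T(1) i] by (simp add: transition_apply[OF is_chart[OF e]])
    moreover have "snd (e i) x \<in> ?I i"
      using x i by (intro imageI) simp
    ultimately show "snd c x \<in> (\<Union>i. transition (e i) c ` ?I i)"
      by (intro UN_I[where a = i] UNIV_I image_eqI[where x = "snd (e i) x"])
  qed
qed

text \<open>Joins the chartwise notion, natural for convergence in measure, to the one needed for
  integration. Forwards, the exceptional set is itself measurable, as Lebesgue measure is complete;
  backwards, it is only contained in a measurable null set.\<close>

lemma (in riemannian) AE_manifold_iff_AE:
  "AE_manifold A P \<longleftrightarrow> (AE x in riemannian_measure A g. P x)"
proof
  assume P: "AE_manifold A P"
  let ?N = "{x. \<not> P x}"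
  have neg: "negligible (snd c ` (?N \<inter> fst c))" if "c \<in> charts A" for c
    using P that unfolding AE_manifold_def by (rule bspec)
  have N: "?N \<in> meas_sets A"
    unfolding meas_sets_def mem_Collect_eq by (intro ballI negligible_imp_sets neg)
  have "negligible (snd (chart_seq A i) ` (?N \<inter> chart_piece i))" for i
    by (rule negligible_subset[OF neg[OF chart_seq(1)[of i]]])
      (intro image_mono Int_mono subset_refl chart_piece_subset)
  then have "emeasure (riemannian_measure A g) ?N = 0"
    unfolding emeasure_riemannian_measure_eq_0_iff[OF N] by (rule allI)
  then show "AE x in riemannian_measure A g. P x"
    using N by (intro AE_I'[of ?N] null_setsI) (simp_all add: sets_riemannian_measure)
next
  assume "AE x in riemannian_measure A g. P x"
  then obtain N where N: "{x. \<not> P x} \<subseteq> N" "N \<in> meas_sets A" "emeasure (riemannian_measure A g) N = 0"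
    by (rule AE_E) (simp add: sets_riemannian_measure)
  show "AE_manifold A P"
    unfolding AE_manifold_def
  proof
    fix c assume c: "c \<in> charts A"
    have "negligible (snd c ` (N \<inter> fst c))"
      using N(3) unfolding emeasure_riemannian_measure_eq_0_iff[OF N(2)]
      by (intro negligible_chart_image[OF chart_seq(1) chart_piece_subset chart_piece_cover _ c]) simp
    then show "negligible (snd c ` ({x. \<not> P x} \<inter> fst c))"
      by (rule negligible_subset) (intro image_mono Int_mono N(1) subset_refl)
  qed
qed


section \<open>Continuity of the norm along fibres\<close>

text \<open>Gram-Schmidt for an arbitrary inner product \<open>b\<close>, finally applied to
  \<open>Basis\<close>. The induction claims only that \<open>F\<close> lies in the span of
  \<open>H\<close>, so a vector depending on the earlier ones is simply skipped.\<close>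

lemma ex_orthonormal_spanning_set:
  fixes b :: "'v::euclidean_space \<Rightarrow> 'v \<Rightarrow> real"
  assumes lin: "\<And>k. linear (\<lambda>h. b h k)" and sym: "\<And>h k. b h k = b k h"
    and pos: "\<And>h. h \<noteq> 0 \<Longrightarrow> b h h > 0"
  shows "\<exists>H. finite H \<and> (\<forall>h\<in>H. \<forall>k\<in>H. b h k = (if h = k then 1 else 0)) \<and> span H = UNIV"
proof -
  have "\<exists>H. finite H \<and> (\<forall>h\<in>H. \<forall>k\<in>H. b h k = (if h = k then 1 else 0)) \<and> F \<subseteq> span H"
    if "finite F" for F
    using that
  proof induction
    case empty
    then show ?case by (intro exI[of _ "{}"]) simp
  next
    case (insert v F)
    then obtain H where H: "finite H" "\<And>h k. h \<in> H \<Longrightarrow> k \<in> H \<Longrightarrow> b h k = (if h = k then 1 else 0)"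
      "F \<subseteq> span H"
      by blast
    \<comment> \<open>The residual of \<open>v\<close> after orthogonal projection to the span of
      \<open>H\<close>; it is zero exactly when \<open>v\<close> contributes nothing new.\<close>
    define w where "w = v - (\<Sum>k\<in>H. b v k *\<^sub>R k)"
    have orth: "b w h = 0" if h: "h \<in> H" for h
    proof -
      have "b w h = b v h - (\<Sum>k\<in>H. b v k * b k h)"
        unfolding w_def by (simp add: linear_diff[OF lin] linear_sum[OF lin] linear_scale[OF lin])
      also have "(\<Sum>k\<in>H. b v k * b k h) = (\<Sum>k\<in>H. if k = h then b v k else 0)"
        using H(2) h by (intro sum.cong) auto
      finally show ?thesis
        using H(1) h by simp
    qed
    have v_eq: "v = w + (\<Sum>k\<in>H. b v k *\<^sub>R k)"
      by (simp add: w_def)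
    show ?case
    proof (cases "w = 0")
      case True
      then have "v \<in> span H"
        by (subst v_eq) (auto intro: span_sum span_scale span_base)
      then show ?thesis
        using H by (intro exI[of _ H]) simp
    next
      case False
      define q where "q = (1 / sqrt (b w w)) *\<^sub>R w"
      have bq: "b q k = (1 / sqrt (b w w)) * b w k" for k
        by (simp add: q_def linear_scale[OF lin])
      have "b q q = (1 / sqrt (b w w)) * ((1 / sqrt (b w w)) * b w w)"
        by (simp only: bq[of q] sym[of w q] bq[of w])
      then have qq: "b q q = 1"
        using pos[OF False] by (simp add: field_simps)
      have qh: "b q h = 0" "b h q = 0" "q \<noteq> h" if "h \<in> H" for h
        using orth[OF that] bq[of h] sym[of h q] qq by auto
      have "v \<in> span (insert q H)"
      proof (subst v_eq, rule span_add)
        have "w = sqrt (b w w) *\<^sub>R q"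
          using pos[OF False] by (simp add: q_def)
        then show "w \<in> span (insert q H)"
          by (metis insertI1 span_base span_scale)
        show "(\<Sum>k\<in>H. b v k *\<^sub>R k) \<in> span (insert q H)"
          by (auto intro: span_sum span_scale span_base)
      qed
      moreover have "F \<subseteq> span (insert q H)"
        using H(3) span_mono[of H "insert q H"] by blast
      moreover have "\<forall>h\<in>insert q H. \<forall>k\<in>insert q H. b h k = (if h = k then 1 else 0)"
        by (intro ballI, elim insertE) (simp_all add: qq qh qh(3)[symmetric] H(2))
      ultimately show ?thesis
        using H(1) by (intro exI[of _ "insert q H"]) simp
    qed
  qed
  from this[OF finite_Basis] obtain H where "finite H"
    "\<forall>h\<in>H. \<forall>k\<in>H. b h k = (if h = k then 1 else 0)" "Basis \<subseteq> span H"
    by blast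
  moreover from this(3) have "span H = UNIV"
    using span_mono[of Basis "span H"] by (simp add: span_span top.extremum_unique)
  ultimately show ?thesis
    by blast
qed

lemma (in atlas) linear_coord_vector:
  assumes "c \<in> charts_at A x"
  shows "linear (\<lambda>h. coord_vector A x c h c')"
  by (intro linearI) (simp_all add: coord_vector_add[OF assms] coord_vector_scaleR[OF assms])

text \<open>\<open>bundle_norm\<close> takes its basis by \<open>SOME\<close>, so existence is what
  makes that basis consist of tangent vectors. It is constructed in the coordinates of one
  chart.\<close>

lemma (in riemannian) ex_orthonormal_basis: "\<exists>S. orthonormal_basis A g x S"
proof -
  obtain c where c: "c \<in> charts_at A x"
    using ex_chart_at by (rule exE)
  let ?v = "coord_vector A x c"
  let ?b = "\<lambda>h k. g x (?v h) (?v k)"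
  have pos: "?b h h > 0" if "h \<noteq> 0" for h
  proof (intro metric_pos coord_vector_in_tangent_space c notI)
    assume "?v h = (\<lambda>c'. 0)"
    then have "?v h c = 0" by simp
    then show False using that by (simp add: coord_vector_self[OF c])
  qed
  have "\<exists>H. finite H \<and> (\<forall>h\<in>H. \<forall>k\<in>H. ?b h k = (if h = k then 1 else 0)) \<and> span H = UNIV"
    by (rule ex_orthonormal_spanning_set, rule linear_metric_coord_left[OF c], rule metric_coord_sym[OF c], erule pos)
  then obtain H where H: "finite H" "\<And>h k. h \<in> H \<Longrightarrow> k \<in> H \<Longrightarrow> ?b h k = (if h = k then 1 else 0)" "span H = UNIV"
    by (elim exE conjE) simp
  have inj: "inj_on ?v H"
    by (rule inj_on_inverseI[of _ "\<lambda>v. v c"]) (rule coord_vector_self[OF c])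
  have "orthonormal_basis A g x (?v ` H)"
    unfolding orthonormal_basis_def
  proof (intro conjI ballI)
    show "finite (?v ` H)"
      using H(1) by (rule finite_imageI)
    show "?v ` H \<subseteq> tangent_space A x"
      by (intro image_subsetI coord_vector_in_tangent_space c)
  next
    fix v w assume "v \<in> ?v ` H" "w \<in> ?v ` H"
    then obtain h k where "h \<in> H" "k \<in> H" "v = ?v h" "w = ?v k"
      by (elim imageE)
    then show "g x v w = (if v = w then 1 else 0)"
      by (simp add: H(2) inj_on_eq_iff[OF inj])
  next
    fix v assume v: "v \<in> tangent_space A x"
    have "v c \<in> span H"
      using H(3) by simp
    then obtain r where r: "v c = (\<Sum>k\<in>H. r k *\<^sub>R k)"
      unfolding span_finite[OF H(1)] by (elim imageE)
    \<comment> \<open>The coefficients must be indexed by tangent vectors; \<open>w c\<close>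
      recovers the element of \<open>H\<close> from which \<open>w\<close> arose.\<close>
    have "v c' = (\<Sum>w\<in>?v ` H. r (w c) *\<^sub>R w c')" for c'
    proof -
      have "v c' = ?v (v c) c'"
        by (simp only: coord_vector_of_tangent[OF v c])
      also have "\<dots> = (\<Sum>k\<in>H. r k *\<^sub>R ?v k c')"
        unfolding r by (simp only: linear_sum[OF linear_coord_vector[OF c]] linear_scale[OF linear_coord_vector[OF c]])
      also have "\<dots> = (\<Sum>w\<in>?v ` H. r (w c) *\<^sub>R w c')"
        by (simp add: sum.reindex[OF inj] coord_vector_self[OF c])
      finally show ?thesis .
    qed
    then show "\<exists>a. v = (\<lambda>c'. \<Sum>w\<in>?v ` H. a w *\<^sub>R w c')"
      by (intro exI[of _ "\<lambda>w. r (w c)"] ext)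
  qed
  then show ?thesis
    by (rule exI)
qed

locale riemannian_pair = A: riemannian A g + B: riemannian B h
  for A :: "('a::{t2_space, second_countable_topology}, 'm::finite) chart set" and g
    and B :: "('b::{t2_space, second_countable_topology}, 'n::finite) chart set" and h
begin

sublocale atlas_pair A B ..

text \<open>All \<open>E l\<close> lie over the same point \<open>x\<close> of \<open>M\<close> as
  \<open>e\<close>, so one and the same chosen basis of the tangent space at \<open>x\<close>
  computes every norm; between different points this choice carries no continuity. Each summand is
  then a polynomial in the coordinates of the image vector and the entries of a Gram matrix, which
  both converge.\<close>

lemma tendsto_bundle_norm:
  assumes lim: "limitin (bundle_topology A B) E e F"
    and E: "\<And>l. E l \<in> hom_bundle A B" and e: "e \<in> hom_bundle A B" and fst: "\<And>l. fst (E l) = fst e"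
  shows "((\<lambda>l. bundle_norm A g h (E l)) \<longlongrightarrow> bundle_norm A g h e) F"
proof -
  obtain x y \<xi> where e_eq: "e = (x, y, \<xi>)" and \<xi>: "\<xi> \<in> hom_space A x B y"
    using hom_bundle_cases[OF e] by metis
  define Y where "Y l = fst (snd (E l))" for l
  define X where "X l = snd (snd (E l))" for l
  have E_eq: "E l = (x, Y l, X l)" for l
    using fst[of l] by (simp add: Y_def X_def e_eq prod_eq_iff)
  have X: "X l \<in> hom_space A x B (Y l)" for l
    using E[of l] by (simp add: E_eq hom_bundle_def)
  obtain a where a: "a \<in> charts_at A x"
    using A.ex_chart_at by (rule exE)
  obtain b where b: "b \<in> charts_at B y"
    using B.ex_chart_at by (rule exE)
  note a' = A.charts_atD[OF a] and b' = B.charts_atD[OF b]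
  have ev: "eventually (\<lambda>l. E l \<in> bundle_box a b W) F" if "open W" "triv A a b e \<in> W" for W
  proof -
    have "e \<in> bundle_box a b W"
      using that e a' b' by (simp add: bundle_box_def e_eq bundle_proj_def)
    then show ?thesis
      using lim openin_bundle_box[OF a'(1) b'(1) that(1)] unfolding limitin_def by simp
  qed
  \<comment> \<open>The charts \<open>a\<close> and \<open>b\<close> stay fixed; boxes over them
    turn convergence in the bundle into convergence of coordinates.\<close>
  have triv: "((\<lambda>l. triv A a b (E l)) \<longlongrightarrow> triv A a b e) F"
    by (rule topological_tendstoI, drule (1) ev) (erule eventually_mono, simp add: bundle_box_def)
  have dom: "eventually (\<lambda>l. Y l \<in> fst b) F"
    using ev[OF open_UNIV UNIV_I] by (rule eventually_mono) (simp add: bundle_box_def E_eq bundle_proj_def)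
  have triv_snd: "fst (snd (triv A a b (x, z, \<zeta>))) = snd b z" for z \<zeta>
    by (simp add: triv_def)
  have "((\<lambda>l. snd b (Y l)) \<longlongrightarrow> snd b y) F"
    using tendsto_fst[OF tendsto_snd[OF triv]] by (simp add: E_eq e_eq triv_snd)
  moreover have "isCont (inv_into (fst b) (snd b)) (snd b y)"
  proof -
    have "open (snd b ` fst b)"
      using B.is_chart[OF b'(1)] unfolding is_chart_def by (elim conjE)
    then show ?thesis
      using chart_inv_continuous[OF B.is_chart[OF b'(1)]] b'(2) by (simp add: continuous_on_eq_continuous_at)
  qed
  ultimately have "((\<lambda>l. inv_into (fst b) (snd b) (snd b (Y l))) \<longlongrightarrow> inv_into (fst b) (snd b) (snd b y)) F"
    by (rule isCont_tendsto_compose[rotated])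
  moreover have "eventually (\<lambda>l. inv_into (fst b) (snd b) (snd b (Y l)) = Y l) F"
    using dom by (rule eventually_mono) (rule chart_inv[OF B.is_chart[OF b'(1)]])
  ultimately have Y: "(Y \<longlongrightarrow> y) F"
    using tendsto_cong chart_inv[OF B.is_chart[OF b'(1)] b'(2)] by force
  have gram: "((\<lambda>l. gram_matrix B h b (Y l) $ i $ j) \<longlongrightarrow> gram_matrix B h b y $ i $ j) F" for i j
  proof -
    have "isCont (\<lambda>y. gram_matrix B h b y $ i $ j) y"
      using B.gram_matrix_continuous[OF b'(1)] b'(2) chart_open_dom[OF B.is_chart[OF b'(1)]]
      by (simp add: continuous_on_eq_continuous_at)
    then show ?thesis
      using Y by (rule isCont_tendsto_compose)
  qed
  \<comment> \<open>For a fixed tangent vector this reduces convergence of its images to convergence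
    of the operators.\<close>
  have blin: "snd (snd (triv A a b (x, z, \<zeta>))) (v a) = \<zeta> v b"
    if "\<zeta> \<in> hom_space A x B z" "v \<in> tangent_space A x" for z \<zeta> v
    by (simp only: triv_apply[OF that(1) a] A.coord_vector_of_tangent[OF that(2) a])
  have coord: "((\<lambda>l. X l v b) \<longlongrightarrow> \<xi> v b) F" if v: "v \<in> tangent_space A x" for v
    using blinfun.tendsto[OF tendsto_snd[OF tendsto_snd[OF triv]] tendsto_const[of "v a"]]
    by (simp add: E_eq e_eq blin[OF X v] blin[OF \<xi> v])
  have expand: "h z (\<zeta> v) (\<zeta> v) = (\<Sum>i\<in>UNIV. \<Sum>j\<in>UNIV. \<zeta> v b $ i * \<zeta> v b $ j * gram_matrix B h b z $ i $ j)"
    if "\<zeta> \<in> hom_space A x B z" "v \<in> tangent_space A x" "z \<in> fst b" for z \<zeta> v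
  proof -
    have bz: "b \<in> charts_at B z"
      using b'(1) that(3) by (simp add: charts_at_def)
    show ?thesis
      using B.metric_coord_expansion[OF bz, of "\<zeta> v b" "\<zeta> v b"]
      by (simp only: B.coord_vector_of_tangent[OF hom_space_tangent[OF that(1,2)] bz])
  qed
  define S where "S = (SOME S. orthonormal_basis A g x S)"
  have "orthonormal_basis A g x S"
    unfolding S_def by (rule someI_ex[OF A.ex_orthonormal_basis])
  then have S: "S \<subseteq> tangent_space A x"
    unfolding orthonormal_basis_def by (elim conjE)
  have lim_v: "((\<lambda>l. h (Y l) (X l v) (X l v)) \<longlongrightarrow> h y (\<xi> v) (\<xi> v)) F" if "v \<in> S" for v
  proof -
    have v: "v \<in> tangent_space A x"
      using S that by (rule subsetD)
    have "((\<lambda>l. \<Sum>i\<in>UNIV. \<Sum>j\<in>UNIV. X l v b $ i * X l v b $ j * gram_matrix B h b (Y l) $ i $ j)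
        \<longlongrightarrow> h y (\<xi> v) (\<xi> v)) F"
      unfolding expand[OF \<xi> v b'(2)] by (intro tendsto_intros coord[OF v] gram)
    moreover have "eventually (\<lambda>l. (\<Sum>i\<in>UNIV. \<Sum>j\<in>UNIV. X l v b $ i * X l v b $ j * gram_matrix B h b (Y l) $ i $ j)
        = h (Y l) (X l v) (X l v)) F"
      using dom by (rule eventually_mono) (rule expand[OF X v, symmetric])
    ultimately show ?thesis
      by (rule Lim_transform_eventually)
  qed
  have "((\<lambda>l. sqrt (\<Sum>v\<in>S. h (Y l) (X l v) (X l v))) \<longlongrightarrow> sqrt (\<Sum>v\<in>S. h y (\<xi> v) (\<xi> v))) F"
    by (intro tendsto_real_sqrt tendsto_sum lim_v)
  then show ?thesis
    by (simp add: bundle_norm_def E_eq e_eq S_def)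
qed

end


section \<open>Convergence along subsequences\<close>

text \<open>If convergence fails, infinitely many terms avoid some neighbourhood of
  \<open>L\<close>; enumerating them gives a subsequence that no further extraction can
  repair.\<close>

lemma LIMSEQ_subsequence_principle:
  fixes X :: "nat \<Rightarrow> 'a::topological_space"
  assumes "\<And>r. strict_mono r \<Longrightarrow> \<exists>s. strict_mono (s :: nat \<Rightarrow> nat) \<and> (\<lambda>l. X (r (s l))) \<longlonglongrightarrow> L"
  shows "X \<longlonglongrightarrow> L"
proof (rule topological_tendstoI, rule ccontr)
  fix S assume S: "open S" "L \<in> S" and "\<not> eventually (\<lambda>l. X l \<in> S) sequentially"
  then have inf: "infinite {l. X l \<notin> S}"
    by (simp add: eventually_cofinite cofinite_eq_sequentially[symmetric])
  define r where "r = enumerate {l. X l \<notin> S}"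
  have r: "strict_mono r" "\<And>l. X (r l) \<notin> S"
    using strict_mono_enumerate[OF inf] enumerate_in_set[OF inf] by (auto simp: r_def)
  obtain s where s: "(\<lambda>l. X (r (s l))) \<longlonglongrightarrow> L"
    using assms[OF r(1)] by blast
  have "eventually (\<lambda>l. X (r (s l)) \<in> S) sequentially"
    using topological_tendstoD[OF s S] .
  then show False
    using r(2) by simp
qed

text \<open>From \<open>f \<le> a + b\<close> follows \<open>f \<le> min f b + a\<close>. The
  minimum is dominated by the fixed function \<open>b\<close> and tends to 0 almost everywhere along
  subsequences, while the integral of \<open>a\<close> tends to 0 by assumption. Both implications
  of the theorem end with this argument.\<close>

lemma integral_tendsto_0_split_dominated:
  fixes f a :: "nat \<Rightarrow> 'x \<Rightarrow> real"
  assumes f: "\<And>l. f l \<in> borel_measurable M" "\<And>l x. 0 \<le> f l x" "\<And>l x. f l x \<le> a l x + b x"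
    and a: "\<And>l. integrable M (a l)" "\<And>l x. 0 \<le> a l x" "(\<lambda>l. \<integral>x. a l x \<partial>M) \<longlonglongrightarrow> 0"
    and b: "integrable M b" "\<And>x. 0 \<le> b x"
    and conv: "\<And>r. strict_mono r \<Longrightarrow>
      \<exists>s. strict_mono (s :: nat \<Rightarrow> nat) \<and> (AE x in M. (\<lambda>l. f (r (s l)) x) \<longlonglongrightarrow> 0)"
  shows "(\<lambda>l. \<integral>x. f l x \<partial>M) \<longlonglongrightarrow> 0"
proof (rule LIMSEQ_subsequence_principle)
  fix r :: "nat \<Rightarrow> nat" assume r: "strict_mono r"
  obtain s where s: "strict_mono s" and ae: "AE x in M. (\<lambda>l. f (r (s l)) x) \<longlonglongrightarrow> 0"
    using conv[OF r] by blast
  let ?k = "\<lambda>l. r (s l)"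
  have int_f: "integrable M (f l)" for l
  proof (rule Bochner_Integration.integrable_bound[OF _ f(1)])
    show "integrable M (\<lambda>x. a l x + b x)"
      using a(1) b(1) by simp
    show "AE x in M. norm (f l x) \<le> norm (a l x + b x)"
    proof (rule AE_I2)
      show "norm (f l x) \<le> norm (a l x + b x)" for x
        using f(2)[of l x] f(3)[of l x] by simp
    qed
  qed
  have meas_min: "(\<lambda>x. min (f l x) (b x)) \<in> borel_measurable M" for l
    using f(1) b(1) by measurable
  have int_min: "integrable M (\<lambda>x. min (f l x) (b x))" for l
    by (rule Bochner_Integration.integrable_bound[OF b(1) meas_min]) (use f(2) b(2) in auto)
  have lim_min: "(\<lambda>l. \<integral>x. min (f (?k l) x) (b x) \<partial>M) \<longlonglongrightarrow> (\<integral>x. 0 \<partial>M)"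
  proof (rule integral_dominated_convergence[OF _ meas_min b(1)])
    show "AE x in M. (\<lambda>l. min (f (?k l) x) (b x)) \<longlonglongrightarrow> 0"
      using ae
    proof eventually_elim
      case (elim x)
      then have "(\<lambda>l. min (f (?k l) x) (b x)) \<longlonglongrightarrow> min 0 (b x)"
        by (intro tendsto_intros)
      then show ?case
        using b(2) by simp
    qed
    show "AE x in M. norm (min (f (?k l) x) (b x)) \<le> b x" for l
      using f(2) b(2) by auto
  qed simp
  have "(\<lambda>l. \<integral>x. a (?k l) x \<partial>M) \<longlonglongrightarrow> 0"
    using LIMSEQ_subseq_LIMSEQ[OF a(3) strict_mono_o[OF r s]] by (simp add: o_def)
  with lim_min have lim: "(\<lambda>l. (\<integral>x. min (f (?k l) x) (b x) \<partial>M) + (\<integral>x. a (?k l) x \<partial>M)) \<longlonglongrightarrow> 0"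
    using tendsto_add by fastforce
  have "(\<lambda>l. \<integral>x. f (?k l) x \<partial>M) \<longlonglongrightarrow> 0"
  proof (rule tendsto_sandwich[OF _ _ tendsto_const lim])
    show "\<forall>\<^sub>F l in sequentially. 0 \<le> (\<integral>x. f (?k l) x \<partial>M)"
      by (simp add: f(2))
    have "(\<integral>x. f l x \<partial>M) \<le> (\<integral>x. min (f l x) (b x) + a l x \<partial>M)" for l
    proof (rule integral_mono[OF int_f Bochner_Integration.integrable_add[OF int_min a(1)]])
      show "f l x \<le> min (f l x) (b x) + a l x" for x
        using f(3)[of l x] a(2)[of l x] by (auto simp: min_def)
    qed
    also have "\<dots> l = (\<integral>x. min (f l x) (b x) \<partial>M) + (\<integral>x. a l x \<partial>M)" for l
      by (rule Bochner_Integration.integral_add[OF int_min a(1)])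
    finally show "\<forall>\<^sub>F l in sequentially. (\<integral>x. f (?k l) x \<partial>M) \<le>
        (\<integral>x. min (f (?k l) x) (b x) \<partial>M) + (\<integral>x. a (?k l) x \<partial>M)"
      by (intro always_eventually allI)
  qed
  then show "\<exists>s. strict_mono s \<and> (\<lambda>l. \<integral>x. f (r (s l)) x \<partial>M) \<longlonglongrightarrow> 0"
    using s by blast
qed

text \<open>At stage \<open>j\<close> only the finitely many sequences with index at most
  \<open>j\<close> have to be small, so the sequence number \<open>i\<close> obeys the bound from
  stage \<open>i\<close> on.\<close>

lemma diagonal_subsequence_bound:
  fixes X :: "nat \<Rightarrow> nat \<Rightarrow> ennreal"
  assumes "\<And>i. X i \<longlonglongrightarrow> 0"
  shows "\<exists>s. strict_mono s \<and> (\<forall>j. \<forall>i\<le>j. X i (s j) < ennreal ((1/2) ^ j))"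
proof -
  have ev: "\<forall>\<^sub>F l in sequentially. \<forall>i\<le>j. X i l < ennreal ((1/2) ^ j)" for j
  proof -
    have "\<forall>\<^sub>F l in sequentially. X i l < ennreal ((1/2) ^ j)" for i
      by (rule order_tendstoD(2)[OF assms]) simp
    then have "\<forall>\<^sub>F l in sequentially. \<forall>i\<in>{..j}. X i l < ennreal ((1/2) ^ j)"
      by (intro eventually_ball_finite) auto
    then show ?thesis
      by (simp only: Ball_def atMost_iff)
  qed
  have ex: "\<exists>l>k. \<forall>i\<le>j. X i l < ennreal ((1/2) ^ j)" for j k
    using eventually_happens[OF eventually_conj[OF eventually_gt_at_top[of k] ev[of j]]] by auto
  have "\<exists>s. \<forall>j. (\<forall>i\<le>j. X i (s j) < ennreal ((1/2) ^ j)) \<and> s j < s (Suc j)"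
  proof (intro dependent_nat_choice)
    show "\<exists>l. \<forall>i\<le>0. X i l < ennreal ((1/2) ^ 0)"
      using ex[where k = 0 and j = 0] by blast
    show "\<exists>k. (\<forall>i\<le>Suc j. X i k < ennreal ((1/2) ^ Suc j)) \<and> l < k" for l j
      using ex[where k = l and j = "Suc j"] by blast
  qed
  then show ?thesis
    by (auto simp: strict_mono_Suc_iff)
qed

text \<open>Borel-Cantelli with a delayed start: the bound is available from \<open>i\<close> on
  only, so the sets are shifted by \<open>i\<close> and their measures compared with a geometric
  series.\<close>

lemma AE_eventually_notin_of_emeasure_bound:
  assumes A: "\<And>j. A j \<in> sets M" and bound: "\<And>j. j \<ge> i \<Longrightarrow> emeasure M (A j) < ennreal ((1/2) ^ j)"
  shows "AE x in M. \<forall>\<^sub>F j in sequentially. x \<notin> A j"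
proof -
  have fin: "emeasure M (A (j + i)) < ennreal ((1/2) ^ (j + i))" for j
    by (rule bound) simp
  have "AE x in M. \<forall>\<^sub>F j in sequentially. x \<in> space M - A (j + i)"
  proof (rule borel_cantelli_AE1)
    show "emeasure M (A (j + i)) < \<infinity>" for j
      using fin[of j] by (rule less_trans) (simp add: ennreal_less_top)
    show "summable (\<lambda>j. measure M (A (j + i)))"
    proof (rule summable_comparison_test')
      show "summable (\<lambda>j. (1/2 :: real) ^ j)"
        by (rule summable_geometric) simp
      show "norm (measure M (A (j + i))) \<le> (1/2) ^ j" for j
      proof -
        have "emeasure M (A (j + i)) \<le> ennreal ((1/2) ^ (j + i))"
          using fin by (rule less_imp_le)
        then have "measure M (A (j + i)) \<le> (1/2) ^ (j + i)"
          unfolding measure_def by (intro enn2real_leI) simp_all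
        also have "\<dots> \<le> (1/2 :: real) ^ j"
          by (rule power_decreasing) simp_all
        finally show ?thesis by simp
      qed
    qed
  qed (rule A)
  then show ?thesis
  proof eventually_elim
    case (elim x)
    then have "\<forall>\<^sub>F j in sequentially. x \<notin> A (j + i)"
      by (rule eventually_mono) simp
    then show ?case
      using eventually_sequentially_seg[of "\<lambda>j. x \<notin> A j" i] by simp
  qed
qed

text \<open>Dominated convergence for indicators. The set \<open>C\<close> of finite measure
  provides the dominating function and prevents mass from escaping to infinity.\<close>

lemma emeasure_tendsto_0_of_AE_eventually_notin:
  assumes A: "\<And>l. A l \<in> sets M" "\<And>l. A l \<subseteq> C" and C: "C \<in> sets M" "emeasure M C < \<infinity>"
    and ae: "AE x in M. \<forall>\<^sub>F l in sequentially. x \<notin> A l"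
  shows "(\<lambda>l. emeasure M (A l)) \<longlonglongrightarrow> 0"
proof -
  have "(\<lambda>l. \<integral>\<^sup>+x. indicator (A l) x \<partial>M) \<longlonglongrightarrow> (\<integral>\<^sup>+x. 0 \<partial>M)"
  proof (rule nn_integral_dominated_convergence)
    show "AE x in M. (indicator (A l) x :: ennreal) \<le> indicator C x" for l
      using A(2)[of l] by (auto simp: indicator_def)
    show "(\<integral>\<^sup>+x. indicator C x \<partial>M) < \<infinity>"
      using C by simp
    show "AE x in M. (\<lambda>l. indicator (A l) x :: ennreal) \<longlonglongrightarrow> 0"
      using ae
    proof eventually_elim
      case (elim x)
      then have "\<forall>\<^sub>F l in sequentially. (indicator (A l) x :: ennreal) = 0"
        by (rule eventually_mono) simp
      then show ?case
        by (rule tendsto_eventually)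
    qed
  qed (use A(1) C(1) in auto)
  then show ?thesis
    using A(1) by simp
qed


section \<open>Local convergence in measure and almost everywhere convergence\<close>

context atlas
begin

lemma converges_loc_measure_subsequence:
  assumes conv: "converges_loc_measure A T w w0" and r: "strict_mono r"
  shows "converges_loc_measure A T (\<lambda>l. w (r l)) w0"
  unfolding converges_loc_measure_def
proof (intro conjI allI)
  show "meas_map A T (w (r l))" "meas_map A T w0" for l
    using conv unfolding converges_loc_measure_def by simp_all
  fix x
  have "\<exists>c\<in>charts_at A x. \<forall>U. openin T U \<longrightarrow>
      (\<lambda>l. emeasure lebesgue (snd c ` ((w0 -` U \<inter> fst c) - w l -` U))) \<longlonglongrightarrow> 0"
    using conv unfolding converges_loc_measure_def by (elim conjE) (rule spec)
  then obtain c where c: "c \<in> charts_at A x" "\<And>U. openin T U \<Longrightarrow>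
      (\<lambda>l. emeasure lebesgue (snd c ` ((w0 -` U \<inter> fst c) - w l -` U))) \<longlonglongrightarrow> 0"
    by (elim bexE) simp
  show "\<exists>c\<in>charts_at A x. \<forall>U. openin T U \<longrightarrow>
      (\<lambda>l. emeasure lebesgue (snd c ` ((w0 -` U \<inter> fst c) - w (r l) -` U))) \<longlonglongrightarrow> 0"
    using LIMSEQ_subseq_LIMSEQ[OF c(2) r] by (intro bexI[OF _ c(1)] allI impI) (simp add: o_def)
qed

text \<open>Convergence at \<open>x\<close> means that every base set containing \<open>w0 x\<close>
  eventually contains \<open>w (s l) x\<close>. Failure at one stage, for one base set and one
  chart, is an event whose measure tends to 0 by assumption.\<close>

lemma converges_loc_measure_imp_AE_subsequence:
  assumes conv: "converges_loc_measure A T w w0"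
    and base: "countable \<G>" "\<forall>G\<in>\<G>. openin T G"
      "\<forall>U e. openin T U \<longrightarrow> e \<in> U \<longrightarrow> (\<exists>G\<in>\<G>. e \<in> G \<and> G \<subseteq> U)"
  shows "\<exists>s. strict_mono s \<and> AE_manifold A (\<lambda>x. limitin T (\<lambda>l. w (s l) x) (w0 x) sequentially)"
proof -
  have w: "\<And>l. meas_map A T (w l)" and w0: "meas_map A T w0"
    and "\<forall>x. \<exists>c\<in>charts_at A x. \<forall>U. openin T U \<longrightarrow>
      (\<lambda>l. emeasure lebesgue (snd c ` ((w0 -` U \<inter> fst c) - w l -` U))) \<longlonglongrightarrow> 0"
    using conv unfolding converges_loc_measure_def by simp_all
  then obtain C where C: "\<And>x. C x \<in> charts_at A x" and
    lim: "\<And>x U. openin T U \<Longrightarrow>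
      (\<lambda>l. emeasure lebesgue (snd (C x) ` ((w0 -` U \<inter> fst (C x)) - w l -` U))) \<longlonglongrightarrow> 0"
    by metis
  have C': "C x \<in> charts A" "x \<in> fst (C x)" for x
    using charts_atD[OF C] by auto
  \<comment> \<open>The chart supplied by the assumption depends on the point; Lindelof leaves
    countably many, and a countable union of null sets is null.\<close>
  have "open V" if "V \<in> range (\<lambda>x. fst (C x))" for V
    using that chart_open_dom[OF is_chart[OF C'(1)]] by (elim rangeE) simp
  then obtain F where F: "F \<subseteq> range (\<lambda>x. fst (C x))" "countable F" "\<Union>F = \<Union>(range (\<lambda>x. fst (C x)))"
    using Lindelof[of "range (\<lambda>x. fst (C x))"] by blast
  obtain Q where Q: "countable Q" "F = (\<lambda>x. fst (C x)) ` Q"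
    using countable_subset_image[THEN iffD1, OF conjI[OF F(2,1)]] by (elim exE conjE)
  have UQ: "\<exists>q\<in>Q. x \<in> fst (C q)" for x
  proof -
    have "x \<in> \<Union>(range (\<lambda>x. fst (C x)))"
      using C'(2) by (intro UN_I[of x]) simp_all
    then have "x \<in> \<Union>((\<lambda>x. fst (C x)) ` Q)"
      unfolding F(3)[symmetric] Q(2) .
    then show ?thesis
      by (simp only: UN_iff)
  qed
  have nonempty: "Q \<noteq> {}" "\<G> \<noteq> {}"
  proof -
    show "Q \<noteq> {}" using UQ by blast
    have "w0 x \<in> topspace T" for x
      using w0 unfolding meas_map_def by (simp add: image_subset_iff)
    then show "\<G> \<noteq> {}"
      using base(3)[rule_format, OF openin_topspace] by blast
  qed
  define c where "c n = C (from_nat_into Q n)" for n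
  define G where "G = from_nat_into \<G>"
  have c: "c n \<in> charts A" for n
    by (simp add: c_def C')
  have G: "openin T (G k)" for k
    unfolding G_def by (intro base(2)[rule_format] from_nat_into nonempty)
  define bad where "bad n k l = snd (c n) ` ((w0 -` G k \<inter> fst (c n)) - w l -` G k)" for n k l
  have bad_meas: "bad n k l \<in> sets lebesgue" for n k l
  proof -
    interpret sigma_algebra UNIV "meas_sets A"
      by (rule sigma_algebra_meas_sets)
    have "w0 -` G k - w l -` G k \<in> meas_sets A"
      using w[of l] w0 G[of k] unfolding meas_map_def by (intro Diff) simp_all
    then have "snd (c n) ` ((w0 -` G k - w l -` G k) \<inter> fst (c n)) \<in> sets lebesgue"
      by (rule meas_sets_image[OF _ c])
    moreover have "(w0 -` G k - w l -` G k) \<inter> fst (c n) = (w0 -` G k \<inter> fst (c n)) - w l -` G k"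
      by blast
    ultimately show ?thesis
      by (simp only: bad_def)
  qed
  \<comment> \<open>Pairs of a chart and a base set are coded by one natural number, so that a
    single diagonal subsequence treats them all.\<close>
  have lim0: "(\<lambda>l. emeasure lebesgue (bad (fst (prod_decode i)) (snd (prod_decode i)) l)) \<longlonglongrightarrow> 0" for i
    unfolding bad_def c_def by (rule lim[OF G])
  obtain s where s: "strict_mono s" and bound: "\<And>i j. i \<le> j \<Longrightarrow>
      emeasure lebesgue (bad (fst (prod_decode i)) (snd (prod_decode i)) (s j)) < ennreal ((1/2) ^ j)"
    using diagonal_subsequence_bound[of "\<lambda>i l. emeasure lebesgue (bad (fst (prod_decode i)) (snd (prod_decode i)) l)", OF lim0]
    by (elim exE conjE) simp
  have ae: "AE z in lebesgue. \<forall>k. \<forall>\<^sub>F j in sequentially. z \<notin> bad n k (s j)" for n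
    unfolding AE_all_countable
  proof
    fix k
    show "AE z in lebesgue. \<forall>\<^sub>F j in sequentially. z \<notin> bad n k (s j)"
    proof (rule AE_eventually_notin_of_emeasure_bound[OF bad_meas])
      \<comment> \<open>The pair \<open>(n, k)\<close> obeys the diagonal bound from the stage given
        by its own code.\<close>
      show "emeasure lebesgue (bad n k (s j)) < ennreal ((1/2) ^ j)" if "prod_encode (n, k) \<le> j" for j
        using bound[OF that] by simp
    qed
  qed
  let ?N = "{x. \<not> limitin T (\<lambda>l. w (s l) x) (w0 x) sequentially}"
  have neg: "negligible (snd (c n) ` (?N \<inter> fst (c n)))" for n
  proof -
    obtain Z where Z: "{z. \<not> (\<forall>k. \<forall>\<^sub>F j in sequentially. z \<notin> bad n k (s j))} \<subseteq> Z" "Z \<in> null_sets lebesgue"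
      using ae[of n] by (rule AE_E) (auto simp: null_sets_def)
    have "snd (c n) ` (?N \<inter> fst (c n)) \<subseteq> Z"
    proof (rule image_subsetI, rule ccontr)
      fix x assume x: "x \<in> ?N \<inter> fst (c n)" and "snd (c n) x \<notin> Z"
      then have ev: "\<forall>\<^sub>F j in sequentially. snd (c n) x \<notin> bad n k (s j)" for k
        using Z(1) by blast
      have "limitin T (\<lambda>l. w (s l) x) (w0 x) sequentially"
        unfolding limitin_def
      proof (intro conjI allI impI)
        show "w0 x \<in> topspace T"
          using w0 unfolding meas_map_def by (simp add: image_subset_iff)
        fix U assume U: "openin T U \<and> w0 x \<in> U"
        then obtain H where H: "H \<in> \<G>" "w0 x \<in> H" "H \<subseteq> U"
          using base(3)[rule_format, of U "w0 x"] by (elim conjE) blast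
        obtain k where k: "G k = H"
          unfolding G_def using from_nat_into_surj[OF base(1) H(1)] by (rule exE)
        show "\<forall>\<^sub>F l in sequentially. w (s l) x \<in> U"
          using ev[of k]
        proof (rule eventually_mono)
          fix j assume j: "snd (c n) x \<notin> bad n k (s j)"
          show "w (s j) x \<in> U"
          proof (rule ccontr)
            assume "w (s j) x \<notin> U"
            then have "w (s j) x \<notin> G k"
              unfolding k by (rule contra_subsetD[OF H(3)])
            then have "x \<in> (w0 -` G k \<inter> fst (c n)) - w (s j) -` G k"
              using x H(2) by (simp add: k)
            then have "snd (c n) x \<in> bad n k (s j)"
              unfolding bad_def by (rule imageI)
            then show False
              using j by (rule notE[rotated])
          qed
        qed
      qed
      then show False
        using x by simp
    qed
    moreover have "negligible Z"
      using Z(2) by (simp add: negligible_iff_null_sets)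
    ultimately show ?thesis
      by (rule negligible_subset[rotated])
  qed
  have cover: "\<exists>n. x \<in> fst (c n)" for x
  proof -
    obtain q where q: "q \<in> Q" "x \<in> fst (C q)"
      by (rule bexE[OF UQ])
    obtain n where "from_nat_into Q n = q"
      using from_nat_into_surj[OF Q(1) q(1)] by (rule exE)
    then show ?thesis
      using q(2) by (intro exI[of _ n]) (simp add: c_def)
  qed
  have "AE_manifold A (\<lambda>x. limitin T (\<lambda>l. w (s l) x) (w0 x) sequentially)"
    unfolding AE_manifold_def
  proof
    fix c' assume "c' \<in> charts A"
    then show "negligible (snd c' ` (?N \<inter> fst c'))"
      by (rule negligible_chart_image[OF c subset_refl cover neg])
  qed
  then show ?thesis
    using s by (intro exI[of _ s] conjI)
qed

text \<open>For a fixed open set the measures in question form a sequence of numbers, so further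
  subsequences decide its limit; along them almost everywhere convergence gives limit 0, provided
  that the chart image has finite measure.\<close>

lemma converges_loc_measureI:
  assumes w: "\<And>l. meas_map A T (w l)" and w0: "meas_map A T w0"
    and ae: "\<And>r. strict_mono r \<Longrightarrow> \<exists>s. strict_mono (s :: nat \<Rightarrow> nat) \<and>
      AE_manifold A (\<lambda>x. limitin T (\<lambda>l. w (r (s l)) x) (w0 x) sequentially)"
  shows "converges_loc_measure A T w w0"
  unfolding converges_loc_measure_def
proof (intro conjI allI w w0)
  fix x
  obtain a where a: "a \<in> charts_at A x"
    using ex_chart_at by (rule exE)
  note a' = charts_atD[OF a] and ch = is_chart[OF charts_atD(1)[OF a]]
  have "open (snd a ` fst a)"
    using ch unfolding is_chart_def by (elim conjE)
  \<comment> \<open>Shrinks the chart so that its image lies in a ball of radius 1 and thus has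
    finite Lebesgue measure.\<close>
  define V where "V = fst a \<inter> snd a -` ball (snd a x) 1"
  have V: "open V" "V \<subseteq> fst a" "x \<in> V"
    using a'(2) chart_continuous[OF ch] chart_open_dom[OF ch]
    by (auto simp: V_def intro: continuous_open_preimage)
  let ?c = "(V, snd a)"
  have c: "?c \<in> charts A"
    by (rule charts_restrict[OF a'(1) V(1,2)])
  have cx: "?c \<in> charts_at A x"
    using c V(3) by (simp add: charts_at_def)
  have lim: "(\<lambda>l. emeasure lebesgue (snd a ` ((w0 -` U \<inter> V) - w l -` U))) \<longlonglongrightarrow> 0" if U: "openin T U" for U
  proof (rule LIMSEQ_subsequence_principle)
    fix r :: "nat \<Rightarrow> nat" assume r: "strict_mono r"
    obtain s where s: "strict_mono s"
      and aes: "AE_manifold A (\<lambda>x. limitin T (\<lambda>l. w (r (s l)) x) (w0 x) sequentially)"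
      using ae[OF r] by (elim exE conjE)
    let ?N = "{x. \<not> limitin T (\<lambda>l. w (r (s l)) x) (w0 x) sequentially}"
    let ?D = "\<lambda>l. snd a ` ((w0 -` U \<inter> V) - w (r (s l)) -` U)"
    have neg: "negligible (snd a ` (?N \<inter> V))"
      using bspec[OF aes[unfolded AE_manifold_def] c] by simp
    have "(\<lambda>l. emeasure lebesgue (?D l)) \<longlonglongrightarrow> 0"
    proof (rule emeasure_tendsto_0_of_AE_eventually_notin)
      show "?D l \<in> sets lebesgue" for l
      proof -
        interpret sigma_algebra UNIV "meas_sets A"
          by (rule sigma_algebra_meas_sets)
        have "w0 -` U - w (r (s l)) -` U \<in> meas_sets A"
          using w[of "r (s l)"] w0 U unfolding meas_map_def by (intro Diff) simp_all
        then have "snd ?c ` ((w0 -` U - w (r (s l)) -` U) \<inter> fst ?c) \<in> sets lebesgue"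
          by (rule meas_sets_image[OF _ c])
        moreover have "(w0 -` U - w (r (s l)) -` U) \<inter> fst ?c = (w0 -` U \<inter> V) - w (r (s l)) -` U"
          by auto
        ultimately show ?thesis
          by simp
      qed
      show "?D l \<subseteq> ball (snd a x) 1" for l
        by (auto simp: V_def)
      show "ball (snd a x) 1 \<in> sets lebesgue" "emeasure lebesgue (ball (snd a x) 1) < \<infinity>"
        using emeasure_lborel_ball_finite[of "snd a x" 1] by simp_all
      show "AE z in lebesgue. \<forall>\<^sub>F l in sequentially. z \<notin> ?D l"
      proof (rule AE_I'[of "snd a ` (?N \<inter> V)"])
        show "snd a ` (?N \<inter> V) \<in> null_sets lebesgue"
          using neg by (simp add: negligible_iff_null_sets)
        show "{z \<in> space lebesgue. \<not> (\<forall>\<^sub>F l in sequentially. z \<notin> ?D l)} \<subseteq> snd a ` (?N \<inter> V)"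
        proof (rule subsetI, rule ccontr)
          fix z assume z: "z \<in> {z \<in> space lebesgue. \<not> (\<forall>\<^sub>F l in sequentially. z \<notin> ?D l)}"
            and zN: "z \<notin> snd a ` (?N \<inter> V)"
          have "\<forall>\<^sub>F l in sequentially. z \<notin> ?D l"
          proof (cases "z \<in> snd a ` (w0 -` U \<inter> V)")
            case False
            then show ?thesis
              by (intro always_eventually allI) blast
          next
            case True
            then obtain y where y: "y \<in> w0 -` U \<inter> V" "z = snd a y"
              by (elim imageE)
            have "y \<notin> ?N"
            proof
              assume "y \<in> ?N"
              then have "z \<in> snd a ` (?N \<inter> V)"
                unfolding y(2) using y(1) by (intro imageI IntI) simp_all
              then show False using zN by simp
            qed
            then have "\<forall>\<^sub>F l in sequentially. w (r (s l)) y \<in> U"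
              using y(1) U unfolding limitin_def by simp
            then show ?thesis
            proof (rule eventually_mono)
              fix l assume l: "w (r (s l)) y \<in> U"
              show "z \<notin> ?D l"
              proof
                assume "z \<in> ?D l"
                \<comment> \<open>The chart is injective, so \<open>y\<close> is the only point of
                  \<open>V\<close> with coordinate \<open>z\<close>.\<close>
                then have "y \<in> (w0 -` U \<inter> V) - w (r (s l)) -` U"
                  unfolding y(2) using y(1) V(2) chart_image_iff[OF ch, of y "(w0 -` U \<inter> V) - w (r (s l)) -` U"]
                  by blast
                then show False
                  using l by simp
              qed
            qed
          qed
          then show False
            using z by simp
        qed
      qed
    qed
    then show "\<exists>s. strict_mono s \<and> (\<lambda>l. emeasure lebesgue (snd a ` ((w0 -` U \<inter> V) - w (r (s l)) -` U))) \<longlonglongrightarrow> 0"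
      using s by (intro exI[of _ s] conjI)
  qed
  show "\<exists>c\<in>charts_at A x. \<forall>U. openin T U \<longrightarrow>
      (\<lambda>l. emeasure lebesgue (snd c ` ((w0 -` U \<inter> fst c) - w l -` U))) \<longlonglongrightarrow> 0"
    using lim by (intro bexI[OF _ cx] allI impI) simp
qed

end


section \<open>Concordant distances\<close>

text \<open>The constant comes from bounding the sum by three times the largest term. Sums of two
  terms are treated with a third one equal to 0.\<close>

lemma powr_sum3_le:
  fixes x y z p :: real
  assumes "0 \<le> x" "0 \<le> y" "0 \<le> z" "0 \<le> p"
  shows "(x + y + z) powr p \<le> 3 powr p * (x powr p + y powr p + z powr p)"
proof -
  let ?m = "max x (max y z)"
  have "(x + y + z) powr p \<le> (3 * ?m) powr p"
    using assms by (intro powr_mono2) auto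
  also have "\<dots> = 3 powr p * ?m powr p"
    using assms by (simp add: powr_mult)
  also have "\<dots> \<le> 3 powr p * (x powr p + y powr p + z powr p)"
    by (intro mult_left_mono) (auto simp: max_def)
  finally show ?thesis .
qed

lemma tendsto_0_powr_iff:
  fixes f :: "nat \<Rightarrow> real"
  assumes "p > 0" "\<And>l. 0 \<le> f l"
  shows "(\<lambda>l. f l powr p) \<longlonglongrightarrow> 0 \<longleftrightarrow> f \<longlonglongrightarrow> 0"
proof
  assume "(\<lambda>l. f l powr p) \<longlonglongrightarrow> 0"
  from tendsto_zero_powrI[OF this tendsto_const[of "1 / p"]]
  have "(\<lambda>l. (f l powr p) powr (1 / p)) \<longlonglongrightarrow> 0"
    using assms by simp
  then show "f \<longlonglongrightarrow> 0"
    using assms by (simp add: powr_powr)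
next
  assume "f \<longlonglongrightarrow> 0"
  from tendsto_zero_powrI[OF this tendsto_const[of p]]
  show "(\<lambda>l. f l powr p) \<longlonglongrightarrow> 0"
    using assms by simp
qed

lemma Lp_convergesI:
  assumes "\<And>l. f l \<in> borel_measurable M" "f0 \<in> Lp M p"
    and "\<And>l. integrable M (\<lambda>x. \<bar>f l x\<bar> powr p)"
    and "(\<lambda>l. \<integral>x. \<bar>f l x - f0 x\<bar> powr p \<partial>M) \<longlonglongrightarrow> 0"
  shows "Lp_converges M p f f0"
  using assms unfolding Lp_converges_def Lp_def by simp

lemma zero_in_Lp: "(\<lambda>x. 0) \<in> Lp M p"
  by (simp add: Lp_def)

lemma meas_map_vimage: "meas_map A T v \<Longrightarrow> openin T U \<Longrightarrow> v -` U \<in> meas_sets A"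
  unfolding meas_map_def by simp

locale concordant_bundle = riemannian_pair A g B h
  for A :: "('a::{t2_space, second_countable_topology}, 'm::finite) chart set" and g
    and B :: "('b::{t2_space, second_countable_topology}, 'n::finite) chart set" and h +
  fixes d :: "('a, 'm, 'b, 'n) hom_el \<Rightarrow> ('a, 'm, 'b, 'n) hom_el \<Rightarrow> real"
  assumes concordant: "concordant A g B h d"
begin

sublocale Metric_space "hom_bundle A B" d
  using concordant unfolding concordant_def by (elim conjE)

lemma mtopology_eq: "mtopology = bundle_topology A B"
  using concordant unfolding concordant_def by (elim conjE)

abbreviation foot :: "('a, 'm, 'b, 'n) hom_el \<Rightarrow> ('a, 'm, 'b, 'n) hom_el" where
  "foot e \<equiv> zero_section A (bundle_proj e)"

lemma foot_in_bundle [simp]: "foot e \<in> hom_bundle A B"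
  using zero_section_in_bundle[of "fst (bundle_proj e)" "snd (bundle_proj e)"] by simp

lemma dist_foot_le: "e1 \<in> hom_bundle A B \<Longrightarrow> e2 \<in> hom_bundle A B \<Longrightarrow> d (foot e1) (foot e2) \<le> d e1 e2"
  using concordant unfolding concordant_def by (elim conjE) simp

lemma ex_concordance_constant:
  "\<exists>\<kappa>>0. \<forall>e\<in>hom_bundle A B. inverse \<kappa> * bundle_norm A g h e \<le> d e (foot e) \<and> d e (foot e) \<le> \<kappa> * bundle_norm A g h e"
  using concordant unfolding concordant_def by (elim conjE)

text \<open>Since \<open>d\<close> induces the bundle topology, the limits obtained from convergence
  in measure and those obtained from integrals of distances are of the same kind.\<close>

lemma limitin_bundle_iff:
  assumes "\<And>l. E l \<in> hom_bundle A B" "e \<in> hom_bundle A B"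
  shows "limitin (bundle_topology A B) E e F \<longleftrightarrow> ((\<lambda>l. d (E l) e) \<longlongrightarrow> 0) F"
  unfolding mtopology_eq[symmetric] limitin_metric_dist_null using assms by simp

text \<open>One point is picked from every nonempty member of a countable base.\<close>

lemma ex_countable_dense:
  "\<exists>D. countable D \<and> D \<subseteq> hom_bundle A B \<and> (\<forall>e\<in>hom_bundle A B. \<forall>r>0. \<exists>q\<in>D. d e q < r)"
proof -
  obtain \<G> where \<G>: "countable \<G>" "\<forall>G\<in>\<G>. openin (bundle_topology A B) G"
    "\<forall>U e. openin (bundle_topology A B) U \<longrightarrow> e \<in> U \<longrightarrow> (\<exists>G\<in>\<G>. e \<in> G \<and> G \<subseteq> U)"
    using ex_countable_base_bundle by (elim exE conjE)
  define pick where "pick G = (SOME q. q \<in> G)" for G :: "('a, 'm, 'b, 'n) hom_el set"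
  have pick: "pick G \<in> G" if "e \<in> G" for e G
    unfolding pick_def by (rule someI[of "\<lambda>q. q \<in> G", OF that])
  let ?D = "pick ` (\<G> - {{}})"
  have "countable ?D"
    using \<G>(1) by (intro countable_image countable_Diff)
  moreover have "?D \<subseteq> hom_bundle A B"
  proof (rule image_subsetI)
    fix G assume G: "G \<in> \<G> - {{}}"
    then obtain e where "e \<in> G"
      by blast
    then show "pick G \<in> hom_bundle A B"
      using pick subsetD[OF bundle_topology_subset[OF \<G>(2)[rule_format, of G]]] G by simp
  qed
  moreover have "\<exists>q\<in>?D. d e q < r" if e: "e \<in> hom_bundle A B" "r > 0" for e r
  proof -
    have ball: "openin (bundle_topology A B) (mball e r)" "e \<in> mball e r"
      using e by (simp_all add: mtopology_eq[symmetric])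
    obtain G where G: "G \<in> \<G>" "e \<in> G" "G \<subseteq> mball e r"
      using \<G>(3)[rule_format, OF ball] by (elim bexE conjE)
    have "pick G \<in> mball e r"
      using G(3) pick[OF G(2)] by (rule subsetD)
    moreover have "pick G \<in> ?D"
      using G(1,2) by (intro imageI) auto
    ultimately show ?thesis
      by (intro bexI[of _ "pick G"]) simp_all
  qed
  ultimately show ?thesis
    by (intro exI[of _ ?D] conjI ballI allI impI)
qed

lemma meas_map_in_bundle: "meas_map A (bundle_topology A B) v \<Longrightarrow> v x \<in> hom_bundle A B"
  unfolding meas_map_def mtopology_eq[symmetric] topspace_mtopology by (simp add: image_subset_iff)

text \<open>Measurability of \<open>v\<close> and \<open>w\<close> controls distances to a fixed
  element only. A sublevel set of the distance between the two maps is a countable union, over a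
  dense set of intermediate elements \<open>q\<close> and rational radii \<open>s\<close>, of
  intersections of such sets.\<close>

lemma meas_map_dist_measurable:
  assumes v: "meas_map A (bundle_topology A B) v" and w: "meas_map A (bundle_topology A B) w"
  shows "(\<lambda>x. d (v x) (w x)) \<in> borel_measurable (riemannian_measure A g)"
  unfolding borel_measurable_iff_less
proof
  fix t :: real
  let ?\<mu> = "riemannian_measure A g"
  note inM = meas_map_in_bundle[OF v] meas_map_in_bundle[OF w]
  obtain D where D: "countable D" "D \<subseteq> hom_bundle A B"
    "\<And>e r. e \<in> hom_bundle A B \<Longrightarrow> r > 0 \<Longrightarrow> \<exists>q\<in>D. d e q < r"
    using ex_countable_dense by (elim exE conjE) simp
  have ball: "{x. d q (v' x) < s} \<in> sets ?\<mu>"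
    if v': "meas_map A (bundle_topology A B) v'" and q: "q \<in> D" for v' q s
  proof -
    have "openin (bundle_topology A B) (mball q s)"
      by (simp add: mtopology_eq[symmetric])
    then have "v' -` mball q s \<in> meas_sets A"
      using v' unfolding meas_map_def by simp
    moreover have "v' -` mball q s = {x. d q (v' x) < s}"
      using meas_map_in_bundle[OF v'] subsetD[OF D(2) q] by auto
    ultimately show ?thesis
      by (simp add: A.sets_riemannian_measure)
  qed
  have "{x. d (v x) (w x) < t} = (\<Union>q\<in>D. \<Union>s\<in>\<rat>. {x. d q (v x) < s} \<inter> {x. d q (w x) < t - s})"
  proof (intro equalityI subsetI)
    fix x assume "x \<in> {x. d (v x) (w x) < t}"
    \<comment> \<open>A radius \<open>s\<close> below a third of the gap leaves
      \<open>s + d (v x) (w x) < t - s\<close>, as the triangle inequality through \<open>q\<close>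
      requires.\<close>
    then have r: "0 < (t - d (v x) (w x)) / 3"
      by simp
    obtain q where q: "q \<in> D" "d (v x) q < (t - d (v x) (w x)) / 3"
      using D(3)[OF inM(1)[of x] r] by (elim bexE)
    obtain s where s: "s \<in> \<rat>" "d (v x) q < s" "s < (t - d (v x) (w x)) / 3"
      using Rats_dense_in_real[OF q(2)] by (elim bexE conjE)
    have tri: "d q (w x) \<le> d q (v x) + d (v x) (w x)"
      by (rule triangle[OF subsetD[OF D(2) q(1)] inM])
    have sym: "d q (v x) = d (v x) q"
      by (rule commute)
    have "d q (v x) < s" "d q (w x) < t - s"
      using q(2) s(2,3) tri r unfolding sym by (simp_all add: field_simps)
    then show "x \<in> (\<Union>q\<in>D. \<Union>s\<in>\<rat>. {x. d q (v x) < s} \<inter> {x. d q (w x) < t - s})"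
      using q(1) s(1) by (intro UN_I[of q D] UN_I[of s \<rat>]) simp_all
  next
    fix x assume "x \<in> (\<Union>q\<in>D. \<Union>s\<in>\<rat>. {x. d q (v x) < s} \<inter> {x. d q (w x) < t - s})"
    then obtain q s where q: "q \<in> D" "d q (v x) < s" "d q (w x) < t - s"
      by blast
    have "d (v x) (w x) \<le> d (v x) q + d q (w x)"
      using subsetD[OF D(2) q(1)] inM by (intro triangle)
    then show "x \<in> {x. d (v x) (w x) < t}"
      using q commute[of q "v x"] by simp
  qed
  also have "\<dots> \<in> sets ?\<mu>"
    by (intro sets.countable_UN'' D(1) countable_rat sets.Int ball v w)
  finally show "{x \<in> space ?\<mu>. d (v x) (w x) < t} \<in> sets ?\<mu>"
    by simp
qed

text \<open>By concordance, projecting to the zero section is a contraction.\<close>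

lemma meas_map_foot:
  assumes v: "meas_map A (bundle_topology A B) v"
  shows "meas_map A (bundle_topology A B) (\<lambda>x. foot (v x))"
  unfolding meas_map_def
proof (intro conjI allI impI)
  show "range (\<lambda>x. foot (v x)) \<subseteq> topspace (bundle_topology A B)"
    unfolding mtopology_eq[symmetric] topspace_mtopology by (intro image_subsetI foot_in_bundle)
  fix U assume U: "openin (bundle_topology A B) U"
  let ?V = "{e \<in> hom_bundle A B. foot e \<in> U}"
  have "openin (bundle_topology A B) ?V"
    unfolding mtopology_eq[symmetric] openin_mtopology
  proof (intro conjI allI impI)
    fix e assume e: "e \<in> ?V"
    then obtain r where r: "r > 0" "mball (foot e) r \<subseteq> U"
      using U unfolding mtopology_eq[symmetric] openin_mtopology by blast
    have "mball e r \<subseteq> ?V"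
    proof
      fix e' assume e': "e' \<in> mball e r"
      then have "d (foot e) (foot e') \<le> d e e'"
        by (intro dist_foot_le) simp_all
      then have "foot e' \<in> mball (foot e) r"
        using e' by simp
      then show "e' \<in> ?V"
        using r(2) e' by auto
    qed
    then show "\<exists>r>0. mball e r \<subseteq> ?V"
      using r(1) by blast
  qed auto
  then have "v -` ?V \<in> meas_sets A"
    by (rule meas_map_vimage[OF v])
  moreover have "(\<lambda>x. foot (v x)) -` U = v -` ?V"
    using meas_map_in_bundle[OF v] by auto
  ultimately show "(\<lambda>x. foot (v x)) -` U \<in> meas_sets A"
    by simp
qed

end

text \<open>The derivatives as abstract measurable sections with p-integrable norm. The conditions
  on \<open>fst\<close> put \<open>w l x\<close> and \<open>w0 x\<close> over the same point
  \<open>x\<close>, as \<open>tendsto_bundle_norm\<close> demands.\<close>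

locale concordant_sequence = concordant_bundle A g B h d
  for A :: "('a::{t2_space, second_countable_topology}, 'm::finite) chart set" and g
    and B :: "('b::{t2_space, second_countable_topology}, 'n::finite) chart set" and h d +
  fixes w :: "nat \<Rightarrow> 'a \<Rightarrow> ('a, 'm, 'b, 'n) hom_el" and w0 :: "'a \<Rightarrow> ('a, 'm, 'b, 'n) hom_el"
    and p :: real
  assumes w_meas: "\<And>l. meas_map A (bundle_topology A B) (w l)"
    and w0_meas: "meas_map A (bundle_topology A B) w0"
    and w_fst: "\<And>l x. fst (w l x) = x" and w0_fst: "\<And>x. fst (w0 x) = x"
    and w_Lp: "\<And>l. (\<lambda>x. bundle_norm A g h (w l x)) \<in> Lp (riemannian_measure A g) p"
    and w0_Lp: "(\<lambda>x. bundle_norm A g h (w0 x)) \<in> Lp (riemannian_measure A g) p"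
    and p: "p \<ge> 1"
begin

abbreviation \<mu> where "\<mu> \<equiv> riemannian_measure A g"
abbreviation nrm where "nrm \<equiv> bundle_norm A g h"

lemma w_in: "w l x \<in> hom_bundle A B" and w0_in: "w0 x \<in> hom_bundle A B"
  using meas_map_in_bundle w_meas w0_meas by auto

definition \<kappa> where
  "\<kappa> = (SOME \<kappa>. \<kappa> > 0 \<and> (\<forall>e\<in>hom_bundle A B. inverse \<kappa> * nrm e \<le> d e (foot e) \<and> d e (foot e) \<le> \<kappa> * nrm e))"

lemma \<kappa>: "\<kappa> > 0" "e \<in> hom_bundle A B \<Longrightarrow> nrm e \<le> \<kappa> * d e (foot e)"
  "e \<in> hom_bundle A B \<Longrightarrow> d e (foot e) \<le> \<kappa> * nrm e"
proof -
  have *: "\<kappa> > 0 \<and> (\<forall>e\<in>hom_bundle A B. inverse \<kappa> * nrm e \<le> d e (foot e) \<and> d e (foot e) \<le> \<kappa> * nrm e)"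
    unfolding \<kappa>_def by (rule someI_ex[OF ex_concordance_constant])
  then show "\<kappa> > 0" by simp
  assume "e \<in> hom_bundle A B"
  then have "inverse \<kappa> * nrm e \<le> d e (foot e)" "d e (foot e) \<le> \<kappa> * nrm e"
    using * by simp_all
  then show "nrm e \<le> \<kappa> * d e (foot e)" "d e (foot e) \<le> \<kappa> * nrm e"
    using \<open>\<kappa> > 0\<close> by (simp_all add: field_simps)
qed

text \<open>Read off from concordance: a positive multiple of the norm is at least a
  distance.\<close>

lemma nrm_nonneg:
  assumes "e \<in> hom_bundle A B"
  shows "0 \<le> nrm e"
proof -
  have "0 \<le> \<kappa> * nrm e"
    by (rule order_trans[OF nonneg \<kappa>(3)[OF assms]])
  then show ?thesis
    using \<kappa>(1) by (simp add: zero_le_mult_iff)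
qed

text \<open>Go from \<open>w l x\<close> to \<open>w0 x\<close>, to the foot of \<open>w0 x\<close>,
  and to the foot of \<open>w l x\<close>. The last step is no longer than the first, which accounts
  for the factor 2; translating distances to feet into norms costs one \<open>\<kappa>\<close> at
  each end. The summand 1 covers the case that the norm of \<open>w0 x\<close> is the larger
  one.\<close>

lemma norm_diff_bound:
  "\<bar>nrm (w l x) - nrm (w0 x)\<bar> \<le> 2 * \<kappa> * d (w l x) (w0 x) + (\<kappa>\<^sup>2 + 1) * nrm (w0 x)"
proof -
  let ?e = "w l x" and ?z = "w0 x"
  have "d ?e (foot ?e) \<le> d ?e ?z + d ?z (foot ?e)"
    "d ?z (foot ?e) \<le> d ?z (foot ?z) + d (foot ?z) (foot ?e)"
    by (intro triangle w_in w0_in foot_in_bundle)+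
  then have "d ?e (foot ?e) \<le> 2 * d ?e ?z + \<kappa> * nrm ?z"
    using dist_foot_le[OF w_in w0_in, of l x x] \<kappa>(3)[OF w0_in, of x] commute[of "foot ?z" "foot ?e"] by simp
  then have "\<kappa> * d ?e (foot ?e) \<le> \<kappa> * (2 * d ?e ?z + \<kappa> * nrm ?z)"
    using \<kappa>(1) by (intro mult_left_mono) simp_all
  then have le: "nrm ?e \<le> 2 * \<kappa> * d ?e ?z + \<kappa>\<^sup>2 * nrm ?z"
    using \<kappa>(2)[OF w_in, of l x] by (simp add: algebra_simps power2_eq_square)
  have "0 \<le> nrm ?e" "0 \<le> nrm ?z"
    by (intro nrm_nonneg w_in w0_in)+
  moreover have "0 \<le> \<kappa> * d ?e ?z" "0 \<le> \<kappa>\<^sup>2 * nrm ?z"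
    using \<kappa>(1) \<open>0 \<le> nrm ?z\<close> by simp_all
  ultimately show ?thesis
    using le by (simp add: algebra_simps abs_le_iff)
qed

text \<open>Go from \<open>w l x\<close> down to its foot, across to the foot of
  \<open>w0 x\<close>, and up. One \<open>\<kappa> * nrm (w0 x)\<close> comes from the last step,
  the other from estimating the norm of \<open>w l x\<close> by the difference of norms plus the
  norm of \<open>w0 x\<close>.\<close>

lemma dist_bound:
  "d (w l x) (w0 x) \<le> \<kappa> * \<bar>nrm (w l x) - nrm (w0 x)\<bar> + d (foot (w l x)) (foot (w0 x)) + 2 * \<kappa> * nrm (w0 x)"
proof -
  let ?e = "w l x" and ?z = "w0 x"
  have "d ?e ?z \<le> d ?e (foot ?e) + d (foot ?e) ?z"
    "d (foot ?e) ?z \<le> d (foot ?e) (foot ?z) + d (foot ?z) ?z"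
    by (intro triangle w_in w0_in foot_in_bundle)+
  then have "d ?e ?z \<le> \<kappa> * nrm ?e + d (foot ?e) (foot ?z) + \<kappa> * nrm ?z"
    using \<kappa>(3)[OF w_in, of l x] \<kappa>(3)[OF w0_in, of x] commute[of "foot ?z" ?z] by simp
  moreover have "\<kappa> * nrm ?e \<le> \<kappa> * (\<bar>nrm ?e - nrm ?z\<bar> + nrm ?z)"
    using \<kappa>(1) by (intro mult_left_mono) simp_all
  ultimately show ?thesis
    by (simp add: algebra_simps)
qed

lemma foot_dist_bound: "d (foot (w l x)) (foot (w0 x)) \<le> d (w l x) (w0 x)"
  by (intro dist_foot_le w_in w0_in)

lemma dist_measurable [measurable]: "(\<lambda>x. d (w l x) (w0 x)) \<in> borel_measurable \<mu>"
  by (intro meas_map_dist_measurable w_meas w0_meas)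

lemma foot_dist_measurable [measurable]: "(\<lambda>x. d (foot (w l x)) (foot (w0 x))) \<in> borel_measurable \<mu>"
  by (intro meas_map_dist_measurable meas_map_foot w_meas w0_meas)

lemma nrm_measurable [measurable]:
  "(\<lambda>x. nrm (w l x)) \<in> borel_measurable \<mu>" "(\<lambda>x. nrm (w0 x)) \<in> borel_measurable \<mu>"
  using w_Lp w0_Lp by (auto simp: Lp_def)

lemma nrm_integrable:
  "integrable \<mu> (\<lambda>x. \<bar>nrm (w l x)\<bar> powr p)" "integrable \<mu> (\<lambda>x. nrm (w0 x) powr p)"
  using w_Lp[of l] w0_Lp nrm_nonneg[OF w0_in] by (auto simp: Lp_def)

lemma AE_limit_of_dist_tendsto:
  assumes "AE x in \<mu>. (\<lambda>l. d (w (k l) x) (w0 x) powr p) \<longlonglongrightarrow> 0"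
  shows "AE x in \<mu>. limitin (bundle_topology A B) (\<lambda>l. w (k l) x) (w0 x) sequentially"
  using assms
proof eventually_elim
  case (elim x)
  then have "(\<lambda>l. d (w (k l) x) (w0 x)) \<longlonglongrightarrow> 0"
    using p by (subst (asm) tendsto_0_powr_iff) simp_all
  then show ?case
    by (subst limitin_bundle_iff) (simp_all add: w_in w0_in)
qed

lemma Lp_dist_imp_strong:
  assumes conv: "Lp_converges \<mu> p (\<lambda>l x. d (w l x) (w0 x)) (\<lambda>x. 0)"
  shows "converges_loc_measure A (bundle_topology A B) w w0"
    and "Lp_converges \<mu> p (\<lambda>l x. nrm (w l x)) (\<lambda>x. nrm (w0 x))"
    and "Lp_converges \<mu> p (\<lambda>l x. d (foot (w l x)) (foot (w0 x))) (\<lambda>x. 0)"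
proof -
  have int: "integrable \<mu> (\<lambda>x. d (w l x) (w0 x) powr p)" for l
    using conv by (simp add: Lp_converges_def Lp_def)
  have lim: "(\<lambda>l. \<integral>x. d (w l x) (w0 x) powr p \<partial>\<mu>) \<longlonglongrightarrow> 0"
    using conv by (simp add: Lp_converges_def)
  \<comment> \<open>This extraction serves twice: for local convergence in measure, and for the
    pointwise limit behind the convergence of the norms.\<close>
  have sub: "\<exists>s. strict_mono (s :: nat \<Rightarrow> nat) \<and>
      (AE x in \<mu>. limitin (bundle_topology A B) (\<lambda>l. w (r (s l)) x) (w0 x) sequentially)"
    if r: "strict_mono r" for r :: "nat \<Rightarrow> nat"
  proof -
    have "(\<lambda>l. \<integral>x. norm (d (w (r l) x) (w0 x) powr p) \<partial>\<mu>) \<longlonglongrightarrow> 0"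
      using LIMSEQ_subseq_LIMSEQ[OF lim r] by (simp add: o_def)
    from tendsto_L1_AE_subseq[OF int this]
    obtain s where s: "strict_mono s" "AE x in \<mu>. (\<lambda>l. d (w (r (s l)) x) (w0 x) powr p) \<longlonglongrightarrow> 0"
      by (elim exE conjE)
    then show ?thesis
      using AE_limit_of_dist_tendsto[of "\<lambda>l. r (s l)"] by (intro exI[of _ s] conjI)
  qed
  show "converges_loc_measure A (bundle_topology A B) w w0"
    using sub by (intro A.converges_loc_measureI w_meas w0_meas) (simp only: A.AE_manifold_iff_AE)
  show "Lp_converges \<mu> p (\<lambda>l x. d (foot (w l x)) (foot (w0 x))) (\<lambda>x. 0)"
  proof (rule Lp_convergesI[OF foot_dist_measurable zero_in_Lp])
    \<comment> \<open>No extraction is called for here: the feet are at most as far apart as the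
      elements.\<close>
    have le: "d (foot (w l x)) (foot (w0 x)) powr p \<le> d (w l x) (w0 x) powr p" for l x
      using p by (intro powr_mono2 foot_dist_bound) simp_all
    have int': "integrable \<mu> (\<lambda>x. d (foot (w l x)) (foot (w0 x)) powr p)" for l
      by (rule Bochner_Integration.integrable_bound[OF int[of l]]) (auto simp: le)
    then show "integrable \<mu> (\<lambda>x. \<bar>d (foot (w l x)) (foot (w0 x))\<bar> powr p)" for l
      by simp
    have "(\<lambda>l. \<integral>x. d (foot (w l x)) (foot (w0 x)) powr p \<partial>\<mu>) \<longlonglongrightarrow> 0"
    proof (rule tendsto_sandwich[OF _ _ tendsto_const lim])
      show "\<forall>\<^sub>F l in sequentially. 0 \<le> (\<integral>x. d (foot (w l x)) (foot (w0 x)) powr p \<partial>\<mu>)"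
        by simp
      show "\<forall>\<^sub>F l in sequentially. (\<integral>x. d (foot (w l x)) (foot (w0 x)) powr p \<partial>\<mu>) \<le>
          (\<integral>x. d (w l x) (w0 x) powr p \<partial>\<mu>)"
        by (intro always_eventually allI integral_mono int int' le)
    qed
    then show "(\<lambda>l. \<integral>x. \<bar>d (foot (w l x)) (foot (w0 x)) - 0\<bar> powr p \<partial>\<mu>) \<longlonglongrightarrow> 0"
      by simp
  qed
  show "Lp_converges \<mu> p (\<lambda>l x. nrm (w l x)) (\<lambda>x. nrm (w0 x))"
  proof (rule Lp_convergesI[OF nrm_measurable(1) w0_Lp nrm_integrable(1)])
    \<comment> \<open>\<open>?a\<close> is the vanishing and \<open>?b\<close> the fixed part of
      \<open>norm_diff_bound\<close>, raised to the power \<open>p\<close>.\<close>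
    let ?a = "\<lambda>l x. 3 powr p * ((2 * \<kappa>) powr p * d (w l x) (w0 x) powr p)"
    let ?b = "\<lambda>x. 3 powr p * ((\<kappa>\<^sup>2 + 1) powr p * nrm (w0 x) powr p)"
    show "(\<lambda>l. \<integral>x. \<bar>nrm (w l x) - nrm (w0 x)\<bar> powr p \<partial>\<mu>) \<longlonglongrightarrow> 0"
    proof (rule integral_tendsto_0_split_dominated[where a = ?a and b = ?b])
      show "\<bar>nrm (w l x) - nrm (w0 x)\<bar> powr p \<le> ?a l x + ?b x" for l x
      proof -
        have "\<bar>nrm (w l x) - nrm (w0 x)\<bar> powr p \<le>
            (2 * \<kappa> * d (w l x) (w0 x) + (\<kappa>\<^sup>2 + 1) * nrm (w0 x) + 0) powr p"
          using p norm_diff_bound[of l x] by (intro powr_mono2) simp_all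
        also have "\<dots> \<le> 3 powr p * ((2 * \<kappa> * d (w l x) (w0 x)) powr p + ((\<kappa>\<^sup>2 + 1) * nrm (w0 x)) powr p + 0 powr p)"
          using p \<kappa>(1) nrm_nonneg[OF w0_in] by (intro powr_sum3_le) simp_all
        also have "\<dots> = ?a l x + ?b x"
          using \<kappa>(1) nrm_nonneg[OF w0_in, of x] p by (simp add: powr_mult distrib_left)
        finally show ?thesis .
      qed
      show "integrable \<mu> (?a l)" for l
        using int[of l] by simp
      show "integrable \<mu> ?b"
        using nrm_integrable(2) by simp
      show "(\<lambda>l. \<integral>x. ?a l x \<partial>\<mu>) \<longlonglongrightarrow> 0"
        using tendsto_mult_right_zero[OF lim, of "3 powr p * (2 * \<kappa>) powr p"] by (simp add: mult.assoc)
      show "\<exists>s. strict_mono (s :: nat \<Rightarrow> nat) \<and>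
          (AE x in \<mu>. (\<lambda>l. \<bar>nrm (w (r (s l)) x) - nrm (w0 x)\<bar> powr p) \<longlonglongrightarrow> 0)"
        if r: "strict_mono r" for r :: "nat \<Rightarrow> nat"
      proof -
        obtain s :: "nat \<Rightarrow> nat" where s: "strict_mono s"
          and ae: "AE x in \<mu>. limitin (bundle_topology A B) (\<lambda>l. w (r (s l)) x) (w0 x) sequentially"
          using sub[OF r] by (elim exE conjE)
        from ae have "AE x in \<mu>. (\<lambda>l. \<bar>nrm (w (r (s l)) x) - nrm (w0 x)\<bar> powr p) \<longlonglongrightarrow> 0"
        proof eventually_elim
          case (elim x)
          then have "(\<lambda>l. nrm (w (r (s l)) x)) \<longlonglongrightarrow> nrm (w0 x)"
            by (rule tendsto_bundle_norm) (simp_all add: w_in w0_in w_fst w0_fst)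
          then have "(\<lambda>l. \<bar>nrm (w (r (s l)) x) - nrm (w0 x)\<bar>) \<longlonglongrightarrow> 0"
            by (intro tendsto_rabs_zero) (simp add: LIM_zero_iff)
          then show ?case
            using p by (subst tendsto_0_powr_iff) simp_all
        qed
        then show ?thesis
          using s by (intro exI[of _ s] conjI)
      qed
    qed simp_all
  qed
qed

lemma strong_imp_Lp_dist:
  assumes meas: "converges_loc_measure A (bundle_topology A B) w w0"
    and nrm: "Lp_converges \<mu> p (\<lambda>l x. nrm (w l x)) (\<lambda>x. nrm (w0 x))"
    and foot: "Lp_converges \<mu> p (\<lambda>l x. d (foot (w l x)) (foot (w0 x))) (\<lambda>x. 0)"
  shows "Lp_converges \<mu> p (\<lambda>l x. d (w l x) (w0 x)) (\<lambda>x. 0)"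
proof -
  have int_foot: "integrable \<mu> (\<lambda>x. d (foot (w l x)) (foot (w0 x)) powr p)" for l
    using foot by (simp add: Lp_converges_def Lp_def)
  have lim_foot: "(\<lambda>l. \<integral>x. d (foot (w l x)) (foot (w0 x)) powr p \<partial>\<mu>) \<longlonglongrightarrow> 0"
    using foot by (simp add: Lp_converges_def)
  have lim_nrm: "(\<lambda>l. \<integral>x. \<bar>nrm (w l x) - nrm (w0 x)\<bar> powr p \<partial>\<mu>) \<longlonglongrightarrow> 0"
    using nrm by (simp add: Lp_converges_def)
  \<comment> \<open>The limit in \<open>Lp_converges\<close> concerns the integral alone, which is 0
    by convention for a non-integrable function; integrability of the difference is therefore
    derived from that of the two norms.\<close>
  have int_nrm: "integrable \<mu> (\<lambda>x. \<bar>nrm (w l x) - nrm (w0 x)\<bar> powr p)" for l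
  proof (rule Bochner_Integration.integrable_bound)
    show "integrable \<mu> (\<lambda>x. 3 powr p * (\<bar>nrm (w l x)\<bar> powr p + nrm (w0 x) powr p))"
      using nrm_integrable by simp
    have "\<bar>nrm (w l x) - nrm (w0 x)\<bar> powr p \<le> 3 powr p * (\<bar>nrm (w l x)\<bar> powr p + nrm (w0 x) powr p)" for x
    proof -
      have "\<bar>nrm (w l x) - nrm (w0 x)\<bar> powr p \<le> (\<bar>nrm (w l x)\<bar> + nrm (w0 x) + 0) powr p"
        using p nrm_nonneg[OF w0_in, of x] by (intro powr_mono2) simp_all
      also have "\<dots> \<le> 3 powr p * (\<bar>nrm (w l x)\<bar> powr p + nrm (w0 x) powr p + 0 powr p)"
        using p nrm_nonneg[OF w0_in, of x] by (intro powr_sum3_le) simp_all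
      finally show ?thesis
        using p by simp
    qed
    then show "AE x in \<mu>. norm (\<bar>nrm (w l x) - nrm (w0 x)\<bar> powr p) \<le>
        norm (3 powr p * (\<bar>nrm (w l x)\<bar> powr p + nrm (w0 x) powr p))"
      by (intro AE_I2) (simp add: abs_mult)
  qed simp
  \<comment> \<open>\<open>?a\<close> collects the two terms of \<open>dist_bound\<close> that
    vanish in the limit, \<open>?b\<close> the fixed one.\<close>
  let ?a = "\<lambda>l x. 3 powr p * (\<kappa> powr p * \<bar>nrm (w l x) - nrm (w0 x)\<bar> powr p + d (foot (w l x)) (foot (w0 x)) powr p)"
  let ?b = "\<lambda>x. 3 powr p * ((2 * \<kappa>) powr p * nrm (w0 x) powr p)"
  have bound: "d (w l x) (w0 x) powr p \<le> ?a l x + ?b x" for l x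
  proof -
    have "d (w l x) (w0 x) powr p \<le>
        (\<kappa> * \<bar>nrm (w l x) - nrm (w0 x)\<bar> + d (foot (w l x)) (foot (w0 x)) + 2 * \<kappa> * nrm (w0 x)) powr p"
      using p by (intro powr_mono2 dist_bound) simp_all
    also have "\<dots> \<le> 3 powr p * ((\<kappa> * \<bar>nrm (w l x) - nrm (w0 x)\<bar>) powr p +
        d (foot (w l x)) (foot (w0 x)) powr p + (2 * \<kappa> * nrm (w0 x)) powr p)"
      using p \<kappa>(1) nrm_nonneg[OF w0_in] by (intro powr_sum3_le) simp_all
    also have "\<dots> = ?a l x + ?b x"
      using \<kappa>(1) nrm_nonneg[OF w0_in, of x] p by (simp add: powr_mult distrib_left)
    finally show ?thesis .
  qed
  have int_a: "integrable \<mu> (?a l)" for l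
    using int_nrm[of l] int_foot[of l] by simp
  have int_b: "integrable \<mu> ?b"
    using nrm_integrable(2) by simp
  \<comment> \<open>That the distances lie in L^p is part of the conclusion; the same bound provides
    it.\<close>
  have int: "integrable \<mu> (\<lambda>x. d (w l x) (w0 x) powr p)" for l
  proof (rule Bochner_Integration.integrable_bound)
    show "integrable \<mu> (\<lambda>x. ?a l x + ?b x)"
      by (intro Bochner_Integration.integrable_add int_a int_b)
    show "AE x in \<mu>. norm (d (w l x) (w0 x) powr p) \<le> norm (?a l x + ?b x)"
    proof (rule AE_I2)
      show "norm (d (w l x) (w0 x) powr p) \<le> norm (?a l x + ?b x)" for x
        using order_trans[OF bound[of l x] abs_ge_self] by simp
    qed
  qed simp
  have "(\<lambda>l. \<integral>x. d (w l x) (w0 x) powr p \<partial>\<mu>) \<longlonglongrightarrow> 0"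
  proof (rule integral_tendsto_0_split_dominated[where a = ?a and b = ?b])
    show "(\<lambda>l. \<integral>x. ?a l x \<partial>\<mu>) \<longlonglongrightarrow> 0"
    proof -
      have "(\<lambda>l. 3 powr p * (\<kappa> powr p * (\<integral>x. \<bar>nrm (w l x) - nrm (w0 x)\<bar> powr p \<partial>\<mu>) +
          (\<integral>x. d (foot (w l x)) (foot (w0 x)) powr p \<partial>\<mu>))) \<longlonglongrightarrow> 3 powr p * (\<kappa> powr p * 0 + 0)"
        by (intro tendsto_intros lim_nrm lim_foot)
      then show ?thesis
        using int_nrm int_foot by simp
    qed
    show "\<exists>s. strict_mono (s :: nat \<Rightarrow> nat) \<and> (AE x in \<mu>. (\<lambda>l. d (w (r (s l)) x) (w0 x) powr p) \<longlonglongrightarrow> 0)"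
      if r: "strict_mono r" for r :: "nat \<Rightarrow> nat"
    proof -
      \<comment> \<open>Local convergence in measure passes to subsequences, so the extraction can
        start from any \<open>r\<close>.\<close>
      have sub: "converges_loc_measure A (bundle_topology A B) (\<lambda>l. w (r l)) w0"
        by (rule A.converges_loc_measure_subsequence[OF meas r])
      obtain \<G> where \<G>: "countable \<G>" "\<forall>G\<in>\<G>. openin (bundle_topology A B) G"
        "\<forall>U e. openin (bundle_topology A B) U \<longrightarrow> e \<in> U \<longrightarrow> (\<exists>G\<in>\<G>. e \<in> G \<and> G \<subseteq> U)"
        using ex_countable_base_bundle by (elim exE conjE)
      obtain s where s: "strict_mono s"
        and "AE_manifold A (\<lambda>x. limitin (bundle_topology A B) (\<lambda>l. w (r (s l)) x) (w0 x) sequentially)"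
        using A.converges_loc_measure_imp_AE_subsequence[OF sub \<G>] by (elim exE conjE)
      then have "AE x in \<mu>. limitin (bundle_topology A B) (\<lambda>l. w (r (s l)) x) (w0 x) sequentially"
        by (simp only: A.AE_manifold_iff_AE)
      then have "AE x in \<mu>. (\<lambda>l. d (w (r (s l)) x) (w0 x) powr p) \<longlonglongrightarrow> 0"
      proof eventually_elim
        case (elim x)
        then have "(\<lambda>l. d (w (r (s l)) x) (w0 x)) \<longlonglongrightarrow> 0"
          by (subst (asm) limitin_bundle_iff) (simp_all add: w_in w0_in)
        then show ?case
          using p by (subst tendsto_0_powr_iff) simp_all
      qed
      then show ?thesis
        using s by (intro exI[of _ s] conjI)
    qed
  qed (use int_a int_b bound in simp_all)
  then show ?thesis
    using int by (intro Lp_convergesI zero_in_Lp dist_measurable) simp_all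
qed

end

theorem proposition4p19:
  fixes A :: "('a::{t2_space, second_countable_topology}, 'm::finite) chart set"
    and g :: "('a, 'm) metric_tensor"
    and B :: "('b::{t2_space, second_countable_topology}, 'n::finite) chart set"
    and h :: "('b, 'n) metric_tensor"
    and p :: real
    and d :: "('a, 'm, 'b, 'n) hom_el \<Rightarrow> ('a, 'm, 'b, 'n) hom_el \<Rightarrow> real"
    and u :: "nat \<Rightarrow> 'a \<Rightarrow> 'b" and u0 :: "'a \<Rightarrow> 'b"
  assumes "riemannian_manifold A g" and "riemannian_manifold B h"
    and "p \<ge> 1"
    and "concordant A g B h d"
    and "\<And>l. u l \<in> sobolev A g B h p" and "u0 \<in> sobolev A g B h p"
  shows "Lp_converges (riemannian_measure A g) p
           (\<lambda>l x. d (colocal_deriv A B (u l) x) (colocal_deriv A B u0 x)) (\<lambda>x. 0)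
     \<longleftrightarrow>
         strongly_converges A g B h p u u0 \<and>
         Lp_converges (riemannian_measure A g) p
           (\<lambda>l x. d (zero_section A (x, u l x)) (zero_section A (x, u0 x))) (\<lambda>x. 0)"
proof -
  interpret concordant_bundle A g B h d
    using assms(1,2,4) by unfold_locales (simp_all add: riemannian_manifold_def)
  have deriv: "meas_map A (bundle_topology A B) (colocal_deriv A B v)"
    "bundle_proj (colocal_deriv A B v x) = (x, v x)"
    "(\<lambda>x. bundle_norm A g h (colocal_deriv A B v x)) \<in> Lp (riemannian_measure A g) p"
    if "v \<in> sobolev A g B h p" for v x
    using that by (simp_all add: sobolev_def has_colocal_weak_derivative_def)
  have fst: "fst (colocal_deriv A B v x) = x" if "v \<in> sobolev A g B h p" for v x
    using deriv(2)[OF that, of x] by (simp add: bundle_proj_def)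
  interpret concordant_sequence A g B h d "\<lambda>l. colocal_deriv A B (u l)" "colocal_deriv A B u0" p
    by unfold_locales (simp_all add: deriv fst assms)
  \<comment> \<open>The derivative of a map at \<open>x\<close> lies over \<open>x\<close> and the
    value of the map there, so distances of the maps are distances of feet.\<close>
  have foot: "zero_section A (x, u l x) = foot (colocal_deriv A B (u l) x)"
    "zero_section A (x, u0 x) = foot (colocal_deriv A B u0 x)" for l x
    by (simp_all add: deriv(2) assms)
  show ?thesis
    unfolding strongly_converges_def foot
  proof
    assume "Lp_converges \<mu> p (\<lambda>l x. d (colocal_deriv A B (u l) x) (colocal_deriv A B u0 x)) (\<lambda>x. 0)"
    then show "(converges_loc_measure A (bundle_topology A B) (\<lambda>l. colocal_deriv A B (u l)) (colocal_deriv A B u0) \<and>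
        Lp_converges \<mu> p (\<lambda>l x. nrm (colocal_deriv A B (u l) x)) (\<lambda>x. nrm (colocal_deriv A B u0 x))) \<and>
        Lp_converges \<mu> p (\<lambda>l x. d (foot (colocal_deriv A B (u l) x)) (foot (colocal_deriv A B u0 x))) (\<lambda>x. 0)"
      by (intro conjI Lp_dist_imp_strong)
  qed (elim conjE, rule strong_imp_Lp_dist)
qed

end
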